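(* Let $A\in\mathbb{R}^{n\times n}$ be an $\tilde{E}_0^s$-matrix. Assume that every legitimate principal pivot transform of $A$ is either an almost $E$ matrix or a completely $\tilde{E}_0^s$-matrix. Then for every $q\in\mathbb{R}^n$, LCP$(q,A)$ is processable by Lemke's algorithm.
   Context: Vector inequalities are componentwise. LCP$(q,A)$: find $w,z\in\mathbb{R}^n$ with $w-Az=q$, $w\ge 0$, $z\ge 0$, $w^Tz=0$. It is feasible if there is $z\ge 0$ with $q+Az\ge 0$. Lemke's algorithm: fix $d\in\mathbb{R}^n$ with $d>0$ and consider the augmented system $w=q+Az+d z_0$, $w,z\ge0$, $z_0\ge 0$. If $q\ge 0$, stop with the solution $z=0$. Otherwise increase $z_0$ from the basis $w$ to the least value making $w\ge 0$, pivot $z_0$ into the basis, and thereafter perform complementary pivots: the entering variable is the complement (in the pair $(w_i,z_i)$) of the variable that just left the basis, with the leaving variable chosen by the minimum ratio test (ties resolved by a standard anti-cycling rule such as the lexicographic rule). The algorithm stops either when $z_0$ leaves the basis, giving a solution of LCP$(q,A)$, or when no variable blocks the entering one (termination on a secondary ray). LCP$(q,A)$ is processable by Lemke's algorithm if the algorithm either terminates at a solution of LCP$(q,A)$ or (terminating on a secondary ray) shows that LCP$(q,A)$ is infeasible, i.e. secondary ray termination occurs only if no $z\ge 0$ satisfies $q+Az\ge 0$. Classes (for a square real matrix $B$ of order $m$): $B$ is semimonotone ($E_0$) if for every $0\neq x\ge 0$ there is $i$ with $x_i>0$ and $(Bx)_i\ge 0$. $B$ is strictly semimonotone ($E$) if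 for every $0\neq x\ge 0$ there is $i$ with $x_i>0$ and $(Bx)_i>0$. $B$ is almost $E$ if all principal submatrices of $B$ of order $m-1$ are $E$ but $B$ is not $E$. $B\in E_0^s$ if $B\in E_0$ and $x\ge 0$, $Bx\ge 0$, $x^TBx=0$ imply $B^Tx\le 0$. $B\in\tilde{E}_0^s$ if $B\in E_0^s$ and for every $x\in \mathrm{SOL}(0,B)=\{x\ge 0: Bx\ge 0,\ x^TBx=0\}$ and every index $i$, $(B^Tx)_i\neq 0$ implies $(Bx)_i\neq 0$. $B$ is completely $\tilde{E}_0^s$ if all its principal submatrices (including $B$) are $\tilde{E}_0^s$-matrices. Principal pivot transform (PPT): for $\alpha\subseteq\{1,\dots,n\}$ with $\det A_{\alpha\alpha}\neq 0$, the PPT of $A$ with respect to $\alpha$ is the matrix $M$ with blocks $M_{\alpha\alpha}=(A_{\alpha\alpha})^{-1}$, $M_{\alpha\bar\alpha}=-(A_{\alpha\alpha})^{-1}A_{\alpha\bar\alpha}$, $M_{\bar\alpha\alpha}=A_{\bar\alpha\alpha}(A_{\alpha\alpha})^{-1}$, $M_{\bar\alpha\bar\alpha}=A_{\bar\alpha\bar\alpha}-A_{\bar\alpha\alpha}(A_{\alpha\alpha})^{-1}A_{\alpha\bar\alpha}$, where $\bar\alpha$ is the complement of $\alpha$; for $\alpha=\emptyset$, $M=A$. The legitimate PPTs of $A$ are all the matrices so obtained. *)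

theory Defs
  imports
    "Jordan_Normal_Form.Determinant"
    "Jordan_Normal_Form.DL_Submatrix"
    "HOL-Library.List_Lexorder"
    "HOL-Library.While_Combinator"
begin

section \<open>The linear complementarity problem\<close>

text \<open>The order on vectors is the componentwise one. (The strict order of the library is
  not componentwise, so strict positivity of a vector is always spelled out.)\<close>

definition lcp_feasible :: "real vec \<Rightarrow> real mat \<Rightarrow> bool" where
  "lcp_feasible q A \<longleftrightarrow>
     (\<exists>z \<in> carrier_vec (dim_col A). 0\<^sub>v (dim_col A) \<le> z \<and> 0\<^sub>v (dim_row A) \<le> q + A *\<^sub>v z)"

definition lcp_solution :: "real vec \<Rightarrow> real mat \<Rightarrow> real vec \<Rightarrow> real vec \<Rightarrow> bool" where
  "lcp_solution q A w z \<longleftrightarrow>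
     w \<in> carrier_vec (dim_row A) \<and> z \<in> carrier_vec (dim_col A) \<and>
     w - A *\<^sub>v z = q \<and> 0\<^sub>v (dim_row A) \<le> w \<and> 0\<^sub>v (dim_col A) \<le> z \<and> w \<bullet> z = 0"


section \<open>Matrix classes\<close>

definition semimonotone :: "real mat \<Rightarrow> bool" where
  "semimonotone B \<longleftrightarrow> square_mat B \<and>
     (\<forall>x \<in> carrier_vec (dim_row B). x \<noteq> 0\<^sub>v (dim_row B) \<longrightarrow> 0\<^sub>v (dim_row B) \<le> x \<longrightarrow>
        (\<exists>i < dim_row B. x $ i > 0 \<and> (B *\<^sub>v x) $ i \<ge> 0))"

definition strictly_semimonotone :: "real mat \<Rightarrow> bool" where
  "strictly_semimonotone B \<longleftrightarrow> square_mat B \<and>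
     (\<forall>x \<in> carrier_vec (dim_row B). x \<noteq> 0\<^sub>v (dim_row B) \<longrightarrow> 0\<^sub>v (dim_row B) \<le> x \<longrightarrow>
        (\<exists>i < dim_row B. x $ i > 0 \<and> (B *\<^sub>v x) $ i > 0))"

definition almost_E :: "real mat \<Rightarrow> bool" where
  "almost_E B \<longleftrightarrow> square_mat B \<and>
     (\<forall>\<beta> \<subseteq> {..<dim_row B}. card \<beta> = dim_row B - 1 \<longrightarrow> strictly_semimonotone (submatrix B \<beta> \<beta>)) \<and>
     \<not> strictly_semimonotone B"

text \<open>The solution set of the homogeneous problem, \<open>SOL(0,B)\<close>.\<close>

definition SOL0 :: "real mat \<Rightarrow> real vec set" where
  "SOL0 B = {x \<in> carrier_vec (dim_row B).
     0\<^sub>v (dim_row B) \<le> x \<and> 0\<^sub>v (dim_row B) \<le> B *\<^sub>v x \<and> x \<bullet> (B *\<^sub>v x) = 0}"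

definition E0s :: "real mat \<Rightarrow> bool" where
  "E0s B \<longleftrightarrow> semimonotone B \<and>
     (\<forall>x \<in> SOL0 B. transpose_mat B *\<^sub>v x \<le> 0\<^sub>v (dim_row B))"

definition E0s_tilde :: "real mat \<Rightarrow> bool" where
  "E0s_tilde B \<longleftrightarrow> E0s B \<and>
     (\<forall>x \<in> SOL0 B. \<forall>i < dim_row B.
        (transpose_mat B *\<^sub>v x) $ i \<noteq> 0 \<longrightarrow> (B *\<^sub>v x) $ i \<noteq> 0)"

definition completely_E0s_tilde :: "real mat \<Rightarrow> bool" where
  "completely_E0s_tilde B \<longleftrightarrow> square_mat B \<and>
     (\<forall>\<beta> \<subseteq> {..<dim_row B}. \<beta> \<noteq> {} \<longrightarrow> E0s_tilde (submatrix B \<beta> \<beta>))"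


section \<open>Principal pivot transforms\<close>

definition is_ppt :: "real mat \<Rightarrow> nat set \<Rightarrow> real mat \<Rightarrow> bool" where
  "is_ppt A \<alpha> M \<longleftrightarrow>
     (let n = dim_row A; \<gamma> = {..<n} - \<alpha> in
        M \<in> carrier_mat n n \<and>
        (\<exists>N \<in> carrier_mat (card \<alpha>) (card \<alpha>).
           inverts_mat (submatrix A \<alpha> \<alpha>) N \<and> inverts_mat N (submatrix A \<alpha> \<alpha>) \<and>
           submatrix M \<alpha> \<alpha> = N \<and>
           submatrix M \<alpha> \<gamma> = - (N * submatrix A \<alpha> \<gamma>) \<and>
           submatrix M \<gamma> \<alpha> = submatrix A \<gamma> \<alpha> * N \<and>
           submatrix M \<gamma> \<gamma> = submatrix A \<gamma> \<gamma> - submatrix A \<gamma> \<alpha> * N * submatrix A \<alpha> \<gamma>))"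

definition legitimate_ppts :: "real mat \<Rightarrow> real mat set" where
  "legitimate_ppts A =
     {M. \<exists>\<alpha> \<subseteq> {..<dim_row A}. det (submatrix A \<alpha> \<alpha>) \<noteq> 0 \<and> is_ppt A \<alpha> M}"


section \<open>Lemke's algorithm\<close>

datatype lemke_var = W nat | Z nat | Z0

fun complement :: "lemke_var \<Rightarrow> lemke_var" where
  "complement (W i) = Z i"
| "complement (Z i) = W i"

text \<open>A tableau with rows \<open>r < n\<close> stands for the equations
  \<open>(\<Sum>v. coef T r v * v) = rhs T r\<close>, solved for the variables \<open>basic T r\<close>.\<close>

record tableau =
  basic :: "nat \<Rightarrow> lemke_var"
  coef :: "nat \<Rightarrow> lemke_var \<Rightarrow> real"
  rhs :: "nat \<Rightarrow> real"

fun system_coef :: "real mat \<Rightarrow> real vec \<Rightarrow> nat \<Rightarrow> lemke_var \<Rightarrow> real" where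
  "system_coef A d r (W i) = (if i = r then 1 else 0)"
| "system_coef A d r (Z i) = - (A $$ (r, i))"
| "system_coef A d r Z0 = - (d $ r)"

definition initial_tableau :: "real vec \<Rightarrow> real vec \<Rightarrow> real mat \<Rightarrow> tableau" where
  "initial_tableau d q A = \<lparr>basic = W, coef = system_coef A d, rhs = vec_index q\<rparr>"

text \<open>Gauss-Jordan pivot: variable \<open>e\<close> becomes basic in row \<open>r\<close>.\<close>

definition pivot :: "nat \<Rightarrow> lemke_var \<Rightarrow> tableau \<Rightarrow> tableau" where
  "pivot r e T = \<lparr>
     basic = (basic T)(r := e),
     coef = (\<lambda>i v. if i = r then coef T r v / coef T r e
                   else coef T i v - coef T i e * (coef T r v / coef T r e)),
     rhs = (\<lambda>i. if i = r then rhs T r / coef T r e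
                else rhs T i - coef T i e * (rhs T r / coef T r e))\<rparr>"

text \<open>Ties are resolved by the lexicographic rule: the columns of the \<open>w\<close>-variables hold the
  inverse \<open>B\<^sup>-\<^sup>1\<close> of the current basis matrix, and the rows of \<open>[B\<^sup>-\<^sup>1q, B\<^sup>-\<^sup>1]\<close>, divided
  by the coefficients of the entering variable, are compared lexicographically. This is the
  ordinary ratio test for \<open>q\<close> perturbed to \<open>q + (\<epsilon>, \<epsilon>\<^sup>2, \<dots>)\<close> with small \<open>\<epsilon> > 0\<close>.\<close>

definition lex_row :: "nat \<Rightarrow> tableau \<Rightarrow> nat \<Rightarrow> real list" where
  "lex_row n T r = rhs T r # map (\<lambda>k. coef T r (W k)) [0..<n]"

definition leaving_row :: "nat \<Rightarrow> tableau \<Rightarrow> lemke_var \<Rightarrow> nat" where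
  "leaving_row n T e =
     arg_min_on (\<lambda>r. map (\<lambda>t. t / coef T r e) (lex_row n T r)) {r. r < n \<and> coef T r e > 0}"

text \<open>The least \<open>z\<^sub>0\<close> with \<open>q + d z\<^sub>0 \<ge> 0\<close> is the maximum of \<open>- q\<^sub>r / d\<^sub>r\<close>, so the first pivot
  takes place in a row where \<open>q\<^sub>r / d\<^sub>r\<close> is minimal.\<close>

definition initial_row :: "real vec \<Rightarrow> real vec \<Rightarrow> real mat \<Rightarrow> nat" where
  "initial_row d q A =
     arg_min_on (\<lambda>r. map (\<lambda>t. t / d $ r) (lex_row (dim_row A) (initial_tableau d q A) r))
       {..<dim_row A}"

datatype lemke_state =
    Active tableau lemke_var  \<comment> \<open>the second component is the entering variable\<close>
  | Solved tableau
  | Secondary_Ray tableau lemke_var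

fun is_active :: "lemke_state \<Rightarrow> bool" where
  "is_active (Active T e) = True"
| "is_active _ = False"

definition lemke_init :: "real vec \<Rightarrow> real vec \<Rightarrow> real mat \<Rightarrow> lemke_state" where
  "lemke_init d q A =
     (if 0\<^sub>v (dim_row A) \<le> q then Solved (initial_tableau d q A)
      else let T = initial_tableau d q A; r = initial_row d q A
           in Active (pivot r Z0 T) (complement (basic T r)))"

fun lemke_step :: "nat \<Rightarrow> lemke_state \<Rightarrow> lemke_state" where
  "lemke_step n (Active T e) =
     (if \<forall>r<n. coef T r e \<le> 0 then Secondary_Ray T e
      else let r = leaving_row n T e; T' = pivot r e T
           in if basic T r = Z0 then Solved T' else Active T' (complement (basic T r)))"
| "lemke_step n s = s"

text \<open>\<open>None\<close> means that the algorithm runs forever.\<close>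

definition lemke :: "real vec \<Rightarrow> real vec \<Rightarrow> real mat \<Rightarrow> lemke_state option" where
  "lemke d q A = while_option is_active (lemke_step (dim_row A)) (lemke_init d q A)"

text \<open>Values of the variables in the basic solution; nonbasic variables are \<open>0\<close>.\<close>

definition var_value :: "nat \<Rightarrow> tableau \<Rightarrow> lemke_var \<Rightarrow> real" where
  "var_value n T v = (\<Sum>r | r < n \<and> basic T r = v. rhs T r)"

definition w_part :: "nat \<Rightarrow> tableau \<Rightarrow> real vec" where
  "w_part n T = vec n (\<lambda>i. var_value n T (W i))"

definition z_part :: "nat \<Rightarrow> tableau \<Rightarrow> real vec" where
  "z_part n T = vec n (\<lambda>i. var_value n T (Z i))"

definition processable_by_lemke :: "real vec \<Rightarrow> real vec \<Rightarrow> real mat \<Rightarrow> bool" where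
  "processable_by_lemke d q A \<longleftrightarrow>
     (case lemke d q A of
        Some (Solved T) \<Rightarrow> lcp_solution q A (w_part (dim_row A) T) (z_part (dim_row A) T)
      | Some (Secondary_Ray T e) \<Rightarrow> \<not> lcp_feasible q A
      | _ \<Rightarrow> False)"

end

theory Submission
  imports Defs
begin

text \<open>A secondary ray at a basic solution with \<open>z\<^sub>0\<close> in the basis yields a nonzero
  \<open>x \<in> SOL(0,A)\<close>, because \<open>A\<close> is semimonotone. Hence \<open>A\<^sup>T x \<le> 0\<close>, and \<open>A\<^sup>T x\<close> vanishes where the
  basic \<open>z\<close>-part does not, so \<open>x\<^sup>T q = - z\<^sub>0 (x\<^sup>T d)\<close>. The same identity holds for the perturbed right
  hand side of the lexicographic rule, which is only increased by the perturbation; therefore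
  \<open>x\<^sup>T q < 0\<close> even if the basic solution is degenerate, and \<open>x\<close> certifies infeasibility.

  Termination is the Lemke-Howson parity argument. A step is determined by the set of basic
  variables and the entering variable, and exchanging the entering variable with its complement
  reverses it. A path of such steps cannot cycle, since the cycle would have to pass through the
  start, which has no predecessor; and it cannot come back to the start from the other side (the
  primary ray), since it would then be a palindrome that turns around at its middle.\<close>

section \<open>Reversible deterministic paths\<close>

text \<open>Finiteness forces a repetition. Reversed steps are deterministic too, so equal states
  have equal predecessors on the path and the repetition slides back to index 0. Then
  \<open>s 0\<close> has a predecessor on the path, whose reversal is a step out of
  \<open>f (s 0)\<close>.\<close>

lemma reversible_no_infinite_path:
  fixes s :: "nat \<Rightarrow> 'k"
  assumes fun_R: "\<And>x y z. R x y \<Longrightarrow> R x z \<Longrightarrow> y = z"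
    and rev_R: "\<And>x y. R x y \<Longrightarrow> R (f y) (f x)"
    and invol: "\<And>x. f (f x) = x"
    and path: "\<And>i. R (s i) (s (Suc i))"
    and fin: "finite (range s)"
    and start: "\<And>y. \<not> R (f (s 0)) y"
  shows False
proof -
  have "\<not> inj s" using fin finite_imageD infinite_UNIV_nat by blast
  then obtain a b where "s a = s b" "a < b"
    by (metis injI linorder_neqE_nat)
  then obtain m where m: "s a = s (a + Suc m)"
    by (metis less_imp_Suc_add add_Suc_right)
  have "s i = s (i + Suc m) \<Longrightarrow> s 0 = s (Suc m)" for i
  proof (induction i)
    case (Suc i)
    have "R (f (s (Suc i))) (f (s i))" using rev_R path by blast
    moreover have "R (f (s (Suc i + Suc m))) (f (s (i + Suc m)))" using rev_R path by (metis add_Suc)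
    ultimately have "f (s i) = f (s (i + Suc m))" using fun_R Suc.prems by metis
    then have "s i = s (i + Suc m)" using invol by metis
    then show ?case using Suc.IH by blast
  qed simp
  then have "s 0 = s (Suc m)" using m by blast
  then show False using rev_R[OF path[of m]] start by metis
qed

text \<open>If the path ended in the reversal of its start, reversing it would give the same path,
  so \<open>s (m - j) = f (s j)\<close>. The middle then breaks: for even \<open>m\<close> it is a
  fixed point of \<open>f\<close>, for odd \<open>m\<close> a step from some \<open>x\<close> to
  \<open>f x\<close>.\<close>

lemma reversible_path_no_return:
  fixes s :: "nat \<Rightarrow> 'k"
  assumes fun_R: "\<And>x y z. R x y \<Longrightarrow> R x z \<Longrightarrow> y = z"
    and rev_R: "\<And>x y. R x y \<Longrightarrow> R (f y) (f x)"
    and invol: "\<And>x. f (f x) = x"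
    and path: "\<And>i. i < m \<Longrightarrow> R (s i) (s (Suc i))"
    and fix_free: "\<And>i. i \<le> m \<Longrightarrow> f (s i) \<noteq> s i"
    and moves: "\<And>x y. R x y \<Longrightarrow> y \<noteq> f x"
  shows "s m \<noteq> f (s 0)"
proof
  assume ret: "s m = f (s 0)"
  have pal: "j \<le> m \<Longrightarrow> s (m - j) = f (s j)" for j
  proof (induction j)
    case 0
    then show ?case using ret by simp
  next
    case (Suc j)
    then have e: "s (m - j) = f (s j)" by simp
    have "R (s (m - Suc j)) (s (m - j))" using path[of "m - Suc j"] Suc.prems
      by (simp add: Suc_diff_Suc Suc_le_lessD)
    then have "R (s j) (f (s (m - Suc j)))" using rev_R e invol by metis
    moreover have "R (s j) (s (Suc j))" using path Suc.prems by simp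
    ultimately show ?case using fun_R invol by metis
  qed
  show False
  proof (cases "even m")
    case True
    then obtain k where k: "m = 2 * k" by blast
    then show False using pal[of k] fix_free[of k] by (simp add: mult_2)
  next
    case False
    then obtain k where k: "m = Suc (2 * k)" by (metis oddE Suc_eq_plus1)
    have "s (Suc k) = f (s k)" using pal[of k] k by (simp add: mult_2 Suc_diff_le)
    then show False using moves path[of k] k by simp
  qed
qed

section \<open>The lexicographic order\<close>

text \<open>Equivalently, the polynomial with coefficients \<open>f 0, ..., f (n - 1)\<close> is
  positive for all sufficiently small positive arguments.\<close>

definition lexpos :: "nat \<Rightarrow> (nat \<Rightarrow> real) \<Rightarrow> bool" where
  "lexpos n f \<longleftrightarrow> (\<exists>i<n. (\<forall>j<i. f j = 0) \<and> f i > 0)"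

lemma lexpos_scale:
  assumes "c > 0" "lexpos n f"
  shows "lexpos n (\<lambda>j. c * f j)"
  using assms unfolding lexpos_def by auto

lemma lexpos_add:
  assumes "lexpos n f" "lexpos n g"
  shows "lexpos n (\<lambda>j. f j + g j)"
proof -
  obtain i k where i: "i < n" "\<forall>j<i. f j = 0" "f i > 0"
    and k: "k < n" "\<forall>j<k. g j = 0" "g k > 0"
    using assms unfolding lexpos_def by blast
  consider "i < k" | "k < i" | "i = k" by linarith
  then show ?thesis
  proof cases
    case 1
    then show ?thesis unfolding lexpos_def using i k by (intro exI[of _ i]) auto
  next
    case 2
    then show ?thesis unfolding lexpos_def using i k by (intro exI[of _ k]) auto
  next
    case 3
    then show ?thesis unfolding lexpos_def using i k by (intro exI[of _ k]) auto
  qed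
qed

lemma lexpos_not_uminus: "lexpos n f \<Longrightarrow> \<not> lexpos n (\<lambda>j. - f j)"
  using lexpos_add[of n f "\<lambda>j. - f j"] by (auto simp: lexpos_def)

lemma lexpos_trichotomy:
  assumes "\<exists>j<n. f j \<noteq> 0"
  shows "lexpos n f \<or> lexpos n (\<lambda>j. - f j)"
proof -
  define i where "i = (LEAST j. f j \<noteq> 0)"
  obtain j where j: "j < n" "f j \<noteq> 0" using assms by blast
  have "f i \<noteq> 0" "i \<le> j" unfolding i_def using j LeastI[of "\<lambda>j. f j \<noteq> 0"] Least_le[of "\<lambda>j. f j \<noteq> 0"] by blast+
  moreover have "\<forall>j<i. f j = 0" unfolding i_def using not_less_Least by blast
  moreover have "i < n" using \<open>i \<le> j\<close> j by simp
  ultimately show ?thesis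
  proof (cases "f i > 0")
    case True
    then show ?thesis using \<open>i < n\<close> \<open>\<forall>j<i. f j = 0\<close> unfolding lexpos_def by blast
  next
    case False
    then have "- f i > 0" using \<open>f i \<noteq> 0\<close> by simp
    then have "lexpos n (\<lambda>j. - f j)" using \<open>i < n\<close> \<open>\<forall>j<i. f j = 0\<close> unfolding lexpos_def by auto
    then show ?thesis ..
  qed
qed

lemma lexpos_nth0: "lexpos (Suc n) f \<Longrightarrow> f 0 \<ge> 0"
  unfolding lexpos_def by (metis less_eq_real_def not_gr_zero order.refl)

text \<open>Translates the comparison of lists, in which the pivoting rule is phrased, into a sign
  condition that survives sums and positive scaling.\<close>

lemma map_upt_less_iff_lexpos:
  "map f [0..<n] < map g [0..<n] \<longleftrightarrow> lexpos n (\<lambda>j. g j - f j)"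
proof
  assume "map f [0..<n] < map g [0..<n]"
  then have "\<exists>i. i < n \<and> take i (map f [0..<n]) = take i (map g [0..<n]) \<and> f i < g i"
    unfolding list_less_def lexord_take_index_conv by auto
  then show "lexpos n (\<lambda>j. g j - f j)"
    unfolding lexpos_def by (auto simp: take_map)
next
  assume "lexpos n (\<lambda>j. g j - f j)"
  then obtain i where i: "i < n" "\<forall>j<i. g j - f j = 0" "g i - f i > 0" unfolding lexpos_def by blast
  then have "take i (map f [0..<n]) = take i (map g [0..<n])" by (auto simp: take_map)
  then show "map f [0..<n] < map g [0..<n]"
    unfolding list_less_def lexord_take_index_conv using i by auto
qed

text \<open>Minimality only says that no row is smaller; distinctness of the rows together with
  trichotomy upgrades this to a strict inequality.\<close>

lemma arg_min_on_lexD: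
  assumes "finite X" "X \<noteq> {}"
    and dist: "\<And>i k. i \<in> X \<Longrightarrow> k \<in> X \<Longrightarrow> i \<noteq> k \<Longrightarrow> \<exists>j<n. g i j \<noteq> g k j"
    and r: "r = arg_min_on (\<lambda>i. map (g i) [0..<n]) X"
  shows "r \<in> X" and "\<And>i. i \<in> X \<Longrightarrow> i \<noteq> r \<Longrightarrow> lexpos n (\<lambda>j. g i j - g r j)"
proof -
  have m: "r \<in> X" "\<not> (\<exists>x\<in>X. map (g x) [0..<n] < map (g r) [0..<n])"
    using arg_min_if_finite[OF assms(1,2), of "\<lambda>i. map (g i) [0..<n]"] unfolding r by blast+
  show "r \<in> X" by (fact m)
  fix i assume i: "i \<in> X" "i \<noteq> r"
  have "\<not> lexpos n (\<lambda>j. - (g i j - g r j))" using m(2) i unfolding map_upt_less_iff_lexpos by auto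
  moreover have "\<exists>j<n. g i j - g r j \<noteq> 0" using dist[OF i(1) m(1) i(2)] by auto
  ultimately show "lexpos n (\<lambda>j. g i j - g r j)" using lexpos_trichotomy[of n "\<lambda>j. g i j - g r j"] by blast
qed

text \<open>A strict minimum leaves \<open>arg_min_on\<close> no choice. This is how the row chosen
  in another tableau is computed.\<close>

lemma arg_min_on_lex_eqI:
  assumes "finite X" "r \<in> X" "\<And>i. i \<in> X \<Longrightarrow> i \<noteq> r \<Longrightarrow> lexpos n (\<lambda>j. g i j - g r j)"
  shows "arg_min_on (\<lambda>i. map (g i) [0..<n]) X = r"
proof (rule ccontr)
  let ?m = "arg_min_on (\<lambda>i. map (g i) [0..<n]) X"
  assume "?m \<noteq> r"
  moreover have "?m \<in> X" "\<not> (\<exists>x\<in>X. map (g x) [0..<n] < map (g ?m) [0..<n])"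
    using arg_min_if_finite[OF assms(1), of "\<lambda>i. map (g i) [0..<n]"] assms(2) by blast+
  ultimately show False using assms(2,3) unfolding map_upt_less_iff_lexpos by blast
qed

section \<open>Tableaus\<close>

text \<open>Entry 0 is the constant term and entry \<open>Suc k\<close> the coefficient of
  \<open>eps^(k+1)\<close> in the perturbed right-hand side, so a row has \<open>Suc n\<close>
  entries.\<close>

definition row_entry :: "tableau \<Rightarrow> nat \<Rightarrow> nat \<Rightarrow> real" where
  "row_entry T r j = (case j of 0 \<Rightarrow> rhs T r | Suc k \<Rightarrow> coef T r (W k))"

lemma lex_row_conv: "lex_row n T r = map (row_entry T r) [0..<Suc n]"
proof -
  have "map (row_entry T r) [0..<Suc n] = row_entry T r 0 # map (row_entry T r) (map Suc [0..<n])"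
    by (simp add: upt_conv_Cons map_Suc_upt del: upt_Suc)
  then show ?thesis unfolding lex_row_def by (simp add: row_entry_def comp_def)
qed

lemma row_entry_pivot:
  "row_entry (pivot r e T) i j = (if i = r then row_entry T r j / coef T r e
     else row_entry T i j - coef T i e * (row_entry T r j / coef T r e))"
  by (cases j) (auto simp: row_entry_def pivot_def)

locale lemke_problem =
  fixes n :: nat and A :: "real mat" and d q :: "real vec"
  assumes A_dim: "A \<in> carrier_mat n n"
    and d_dim: "d \<in> carrier_vec n" and d_pos: "\<And>i. i < n \<Longrightarrow> d $ i > 0"
    and q_dim: "q \<in> carrier_vec n"
begin

abbreviation S :: "nat \<Rightarrow> lemke_var \<Rightarrow> real" where "S \<equiv> system_coef A d"

definition vars :: "lemke_var set" where "vars = W ` {..<n} \<union> Z ` {..<n} \<union> {Z0}"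

definition basis :: "tableau \<Rightarrow> lemke_var set" where "basis T = basic T ` {..<n}"

text \<open>The \<open>W\<close> columns serve as the multiplier matrix that turns the original
  system into the tableau, so no history of pivots has to be recorded. The last conjunct does not
  mention \<open>Z0\<close>; bases containing it are therefore covered as well.\<close>

definition complementary_tableau :: "tableau \<Rightarrow> bool" where
  "complementary_tableau T \<longleftrightarrow>
     (\<forall>r<n. \<forall>s<n. coef T r (basic T s) = of_bool (r = s)) \<and>
     (\<forall>r<n. \<forall>v. coef T r v = (\<Sum>k<n. coef T r (W k) * S k v)) \<and>
     (\<forall>r<n. rhs T r = (\<Sum>k<n. coef T r (W k) * q $ k)) \<and>
     basis T \<subseteq> vars \<and> (\<forall>i. \<not> (W i \<in> basis T \<and> Z i \<in> basis T))"

text \<open>The basic variables are strictly positive for the perturbed right-hand side, although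
  some may vanish for \<open>q\<close> itself.\<close>

definition lex_feasible :: "tableau \<Rightarrow> bool" where
  "lex_feasible T \<longleftrightarrow> (\<forall>r<n. lexpos (Suc n) (row_entry T r))"

lemma finite_vars: "finite vars" by (simp add: vars_def)

context
  fixes T :: tableau
  assumes T: "complementary_tableau T"
begin

lemma coef_basic: "r < n \<Longrightarrow> s < n \<Longrightarrow> coef T r (basic T s) = of_bool (r = s)"
  using T unfolding complementary_tableau_def by blast

lemma coef_expand: "r < n \<Longrightarrow> coef T r v = (\<Sum>k<n. coef T r (W k) * S k v)"
  using T unfolding complementary_tableau_def by blast

lemma rhs_expand: "r < n \<Longrightarrow> rhs T r = (\<Sum>k<n. coef T r (W k) * q $ k)"
  using T unfolding complementary_tableau_def by blast

lemma basis_vars: "basis T \<subseteq> vars"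
  using T unfolding complementary_tableau_def by blast

lemma basis_complementary: "\<not> (W i \<in> basis T \<and> Z i \<in> basis T)"
  using T unfolding complementary_tableau_def by blast

lemma basic_inj: "inj_on (basic T) {..<n}"
proof (rule inj_onI)
  fix r s assume "r \<in> {..<n}" "s \<in> {..<n}" "basic T r = basic T s"
  then have "coef T r (basic T r) = coef T r (basic T s)" "r < n" "s < n" by auto
  then show "r = s" using coef_basic[of r r] coef_basic[of r s] by simp
qed

lemma basis_card: "card (basis T) = n"
  unfolding basis_def using card_image[OF basic_inj] by simp

text \<open>The \<open>w\<close>-columns form a left inverse of the basis matrix, hence also a right inverse.\<close>

lemma basis_inverse:
  assumes "j < n" "k < n"
  shows "(\<Sum>r<n. S k (basic T r) * coef T r (W j)) = of_bool (k = j)"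
proof -
  define B where "B = mat n n (\<lambda>(k, r). S k (basic T r))"
  define P where "P = mat n n (\<lambda>(r, j). coef T r (W j))"
  have BP: "B \<in> carrier_mat n n" "P \<in> carrier_mat n n" by (auto simp: B_def P_def)
  have "P * B = 1\<^sub>m n"
  proof (rule eq_matI)
    fix i s assume "i < dim_row (1\<^sub>m n :: real mat)" "s < dim_col (1\<^sub>m n :: real mat)"
    then have "i < n" "s < n" by auto
    then show "(P * B) $$ (i, s) = 1\<^sub>m n $$ (i, s)"
      using coef_expand[of i "basic T s"] coef_basic[of i s]
      by (auto simp: B_def P_def scalar_prod_def atLeast0LessThan)
  qed (auto simp: BP P_def B_def)
  then have "B * P = 1\<^sub>m n" by (rule mat_mult_left_right_inverse[OF BP(2,1)])
  then have "(B * P) $$ (k, j) = 1\<^sub>m n $$ (k, j)" by simp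
  then show ?thesis using assms
    by (simp add: B_def P_def scalar_prod_def atLeast0LessThan)
qed

lemma sum_basis_inverse:
  assumes "k < n"
  shows "(\<Sum>r<n. S k (basic T r) * (\<Sum>j<n. coef T r (W j) * f j)) = f k"
proof -
  have "(\<Sum>r<n. S k (basic T r) * (\<Sum>j<n. coef T r (W j) * f j))
      = (\<Sum>j<n. (\<Sum>r<n. S k (basic T r) * coef T r (W j)) * f j)"
    by (simp add: sum_distrib_left sum_distrib_right mult.assoc) (rule sum.swap)
  also have "\<dots> = (\<Sum>j<n. if k = j then f j else 0)"
    using assms by (intro sum.cong) (auto simp: basis_inverse)
  also have "\<dots> = f k" using assms by simp
  finally show ?thesis .
qed

text \<open>Undoes the row multiplication: the basis matrix times a tableau column gives back the
  original column.\<close>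

lemma system_expand:
  assumes "k < n"
  shows "S k v = (\<Sum>r<n. S k (basic T r) * coef T r v)"
proof -
  have "(\<Sum>r<n. S k (basic T r) * coef T r v)
      = (\<Sum>r<n. S k (basic T r) * (\<Sum>j<n. coef T r (W j) * S j v))"
    using coef_expand by (intro sum.cong) auto
  then show ?thesis using sum_basis_inverse[OF assms, of "\<lambda>j. S j v"] by simp
qed

lemma system_rhs_expand:
  assumes "k < n"
  shows "q $ k = (\<Sum>r<n. S k (basic T r) * rhs T r)"
proof -
  have "(\<Sum>r<n. S k (basic T r) * rhs T r)
      = (\<Sum>r<n. S k (basic T r) * (\<Sum>j<n. coef T r (W j) * q $ j))"
    using rhs_expand by (intro sum.cong) auto
  then show ?thesis using sum_basis_inverse[OF assms, of "\<lambda>j. q $ j"] by simp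
qed

end

section \<open>Dependence of the tableau rows on the basis\<close>

text \<open>A basis determines the tableau up to the order of its rows: the multipliers of row
  \<open>r'\<close> send the basic columns of \<open>T\<close> to a unit vector, and every column,
  as well as \<open>q\<close>, is a combination of these columns with entries of \<open>T\<close> as
  weights.\<close>

lemma row_unique:
  assumes T: "complementary_tableau T" and T': "complementary_tableau T'"
    and same: "basis T = basis T'" and r: "r < n" "r' < n" "basic T r = basic T' r'"
  shows "coef T r v = coef T' r' v" and "rhs T r = rhs T' r'"
proof -
  have d: "(\<Sum>k<n. coef T' r' (W k) * S k (basic T s)) = of_bool (s = r)" if "s < n" for s
  proof -
    have "basic T s \<in> basis T'" using same that by (auto simp: basis_def)
    then obtain s' where s': "s' < n" "basic T s = basic T' s'" by (auto simp: basis_def)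
    have "(s = r) = (s' = r')"
      using basic_inj[OF T] basic_inj[OF T'] s' r that by (metis inj_onD lessThan_iff)
    then show ?thesis
      using coef_expand[OF T' r(2), of "basic T s"] coef_basic[OF T' r(2) s'(1)] s'(2) by auto
  qed
  have swap: "(\<Sum>k<n. coef T' r' (W k) * (\<Sum>s<n. S k (basic T s) * g s)) = g r" for g
  proof -
    have "(\<Sum>k<n. coef T' r' (W k) * (\<Sum>s<n. S k (basic T s) * g s))
        = (\<Sum>s<n. (\<Sum>k<n. coef T' r' (W k) * S k (basic T s)) * g s)"
      by (simp add: sum_distrib_left sum_distrib_right mult.assoc) (rule sum.swap)
    also have "\<dots> = (\<Sum>s<n. if r = s then g s else 0)" by (intro sum.cong) (auto simp: d)
    also have "\<dots> = g r" using r(1) by simp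
    finally show ?thesis .
  qed
  have "coef T' r' v = (\<Sum>k<n. coef T' r' (W k) * (\<Sum>s<n. S k (basic T s) * coef T s v))"
    unfolding coef_expand[OF T' r(2), of v] using system_expand[OF T, of _ v]
    by (intro sum.cong) auto
  then show "coef T r v = coef T' r' v" using swap by simp
  have "rhs T' r' = (\<Sum>k<n. coef T' r' (W k) * (\<Sum>s<n. S k (basic T s) * rhs T s))"
    unfolding rhs_expand[OF T' r(2)] using system_rhs_expand[OF T]
    by (intro sum.cong) auto
  then show "rhs T r = rhs T' r'" using swap by simp
qed

lemma row_entry_unique:
  assumes "complementary_tableau T" "complementary_tableau T'"
    and "basis T = basis T'" "r < n" "r' < n" "basic T r = basic T' r'"
  shows "row_entry T r = row_entry T' r'"
  using row_unique[OF assms] by (auto simp: row_entry_def fun_eq_iff split: nat.split)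

section \<open>Effect of a pivot on complementary tableaus\<close>

lemma basis_pivot:
  assumes "complementary_tableau T" "r < n"
  shows "basis (pivot r e T) = insert e (basis T - {basic T r})"
  using assms(2) inj_on_image_set_diff[OF basic_inj[OF assms(1)], of "{..<n}" "{r}"]
  by (auto simp: basis_def pivot_def)

text \<open>Row operations act on all columns alike, so every row keeps its multipliers in its own
  \<open>W\<close> columns. The premise on \<open>complement e\<close> is guarded because
  \<open>complement\<close> has no equation for \<open>Z0\<close>.\<close>

lemma complementary_tableau_pivot:
  assumes T: "complementary_tableau T" and r: "r < n" and nz: "coef T r e \<noteq> 0"
    and e: "e \<in> vars" "e \<noteq> Z0 \<Longrightarrow> complement e \<notin> basis T"
  shows "complementary_tableau (pivot r e T)"
  unfolding complementary_tableau_def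
proof (intro conjI allI impI)
  fix i s assume "i < n" "s < n"
  then show "coef (pivot r e T) i (basic (pivot r e T) s) = of_bool (i = s)"
    using coef_basic[OF T \<open>i < n\<close> \<open>s < n\<close>] coef_basic[OF T r \<open>s < n\<close>] nz
    by (auto simp: pivot_def)
next
  fix i v assume i: "i < n"
  have "coef T i v - coef T i e * (coef T r v / coef T r e)
      = (\<Sum>k<n. (coef T i (W k) - coef T i e * (coef T r (W k) / coef T r e)) * S k v)"
    unfolding coef_expand[OF T i, of v] coef_expand[OF T r, of v]
    by (simp add: algebra_simps sum_subtractf sum_distrib_left sum_divide_distrib)
  moreover have "coef T r v / coef T r e = (\<Sum>k<n. coef T r (W k) / coef T r e * S k v)"
    unfolding coef_expand[OF T r, of v] by (simp add: sum_divide_distrib)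
  ultimately show "coef (pivot r e T) i v = (\<Sum>k<n. coef (pivot r e T) i (W k) * S k v)"
    by (simp add: pivot_def)
next
  fix i assume i: "i < n"
  have "rhs T i - coef T i e * (rhs T r / coef T r e)
      = (\<Sum>k<n. (coef T i (W k) - coef T i e * (coef T r (W k) / coef T r e)) * q $ k)"
    unfolding rhs_expand[OF T i] rhs_expand[OF T r]
    by (simp add: algebra_simps sum_subtractf sum_distrib_left sum_divide_distrib)
  moreover have "rhs T r / coef T r e = (\<Sum>k<n. coef T r (W k) / coef T r e * q $ k)"
    unfolding rhs_expand[OF T r] by (simp add: sum_divide_distrib)
  ultimately show "rhs (pivot r e T) i = (\<Sum>k<n. coef (pivot r e T) i (W k) * q $ k)"
    by (simp add: pivot_def)
next
  show "basis (pivot r e T) \<subseteq> vars"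
    using basis_pivot[OF T r] basis_vars[OF T] e(1) by auto
next
  fix i
  show "\<not> (W i \<in> basis (pivot r e T) \<and> Z i \<in> basis (pivot r e T))"
    using basis_pivot[OF T r, of e] basis_complementary[OF T, of i] e(2) by (cases e) auto
qed

lemma complementary_initial: "complementary_tableau (initial_tableau d q A)"
proof -
  let ?T = "initial_tableau d q A"
  have delta: "(\<Sum>k<n. coef ?T r (W k) * f k) = f r" if "r < n" for r f
  proof -
    have "(\<Sum>k<n. coef ?T r (W k) * f k) = (\<Sum>k<n. if r = k then f k else 0)"
      by (intro sum.cong) (auto simp: initial_tableau_def)
    then show ?thesis using that by simp
  qed
  have "coef ?T r (basic ?T s) = of_bool (r = s)" for r s
    by (simp add: initial_tableau_def)
  moreover have "basis ?T = W ` {..<n}" by (simp add: basis_def initial_tableau_def)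
  ultimately show ?thesis
    unfolding complementary_tableau_def delta by (auto simp: vars_def delta initial_tableau_def)
qed

text \<open>Two rows that tie in the lexicographic ratio test would be proportional, but only the
  first of them has a nonzero entry in the column of its own basic variable.\<close>

lemma rows_not_proportional:
  assumes T: "complementary_tableau T" and "i < n" "r < n" "i \<noteq> r"
  shows "\<exists>j<Suc n. row_entry T i j \<noteq> c * row_entry T r j"
proof (rule ccontr)
  assume "\<not> ?thesis"
  then have e: "row_entry T i (Suc k) = c * row_entry T r (Suc k)" if "k < n" for k
    using that by blast
  have "coef T i (basic T i) = (\<Sum>k<n. c * coef T r (W k) * S k (basic T i))"
    unfolding coef_expand[OF T \<open>i < n\<close>, of "basic T i"]
    using e by (intro sum.cong) (auto simp: row_entry_def)
  also have "\<dots> = c * coef T r (basic T i)"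
    unfolding coef_expand[OF T \<open>r < n\<close>, of "basic T i"] by (simp add: sum_distrib_left mult.assoc)
  finally show False using coef_basic[OF T] assms by auto
qed

section \<open>The lexicographic ratio test\<close>

lemma ratio_neq:
  fixes a b c c' :: real
  assumes "c > 0" "a \<noteq> c / c' * b"
  shows "a / c \<noteq> b / c'"
proof
  assume "a / c = b / c'"
  then have "c * (a / c) = c * (b / c')" by simp
  then show False using assms by simp
qed

lemma map_divide_lex_row:
  "map (\<lambda>t. t / c) (lex_row n T r) = map (\<lambda>j. row_entry T r j / c) [0..<Suc n]"
  unfolding lex_row_conv by (simp add: comp_def)

lemma leaving_row_conv:
  "leaving_row n T e = arg_min_on (\<lambda>i. map (\<lambda>j. row_entry T i j / coef T i e) [0..<Suc n])
     {i. i < n \<and> coef T i e > 0}"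
  unfolding leaving_row_def map_divide_lex_row ..

text \<open>Since no two rows are proportional, the ratios have no ties, and the minimum is
  strict.\<close>

lemma leaving_rowD:
  assumes T: "complementary_tableau T" and ex: "\<exists>i<n. coef T i e > 0"
    and r: "r = leaving_row n T e"
  shows "r < n" and "coef T r e > 0"
    and "\<And>i. i < n \<Longrightarrow> coef T i e > 0 \<Longrightarrow> i \<noteq> r \<Longrightarrow>
       lexpos (Suc n) (\<lambda>j. row_entry T i j / coef T i e - row_entry T r j / coef T r e)"
proof -
  let ?X = "{i. i < n \<and> coef T i e > 0}"
  have X: "finite ?X" "?X \<noteq> {}" using ex by auto
  have dist: "\<exists>j<Suc n. row_entry T i j / coef T i e \<noteq> row_entry T k j / coef T k e"
    if "i \<in> ?X" "k \<in> ?X" "i \<noteq> k" for i k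
  proof -
    have "\<exists>j<Suc n. row_entry T i j \<noteq> coef T i e / coef T k e * row_entry T k j"
      by (rule rows_not_proportional[OF T]) (use that in auto)
    then obtain j where "j < Suc n" "row_entry T i j \<noteq> coef T i e / coef T k e * row_entry T k j"
      by blast
    moreover have "coef T i e > 0" using that by simp
    ultimately show ?thesis using ratio_neq[of "coef T i e" "row_entry T i j" "coef T k e" "row_entry T k j"] by blast
  qed
  note D = arg_min_on_lexD[OF X dist r[unfolded leaving_row_conv]]
  show "r < n" "coef T r e > 0" using D(1) by auto
  show "lexpos (Suc n) (\<lambda>j. row_entry T i j / coef T i e - row_entry T r j / coef T r e)"
    if "i < n" "coef T i e > 0" "i \<noteq> r" for i
    using D(2)[of i] that by simp
qed

lemma leaving_row_eqI:
  assumes "r < n" "coef T r e > 0"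
    and "\<And>i. i < n \<Longrightarrow> coef T i e > 0 \<Longrightarrow> i \<noteq> r \<Longrightarrow>
       lexpos (Suc n) (\<lambda>j. row_entry T i j / coef T i e - row_entry T r j / coef T r e)"
  shows "leaving_row n T e = r"
  unfolding leaving_row_conv using assms by (intro arg_min_on_lex_eqI) auto

text \<open>The same argument with \<open>d\<close>, the negated column of \<open>Z0\<close>, as the
  column of divisors; all rows compete because \<open>d\<close> is positive.\<close>

lemma initial_rowD:
  assumes "n > 0" and r: "r = initial_row d q A"
  shows "r < n"
    and "\<And>i. i < n \<Longrightarrow> i \<noteq> r \<Longrightarrow> lexpos (Suc n)
       (\<lambda>j. row_entry (initial_tableau d q A) i j / d $ i - row_entry (initial_tableau d q A) r j / d $ r)"
proof -
  let ?T = "initial_tableau d q A"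
  have X: "finite {..<n}" "{..<n} \<noteq> {}" using assms by auto
  have dist: "\<exists>j<Suc n. row_entry ?T i j / d $ i \<noteq> row_entry ?T k j / d $ k"
    if ik: "i \<in> {..<n}" "k \<in> {..<n}" "i \<noteq> k" for i k
  proof -
    have "\<exists>j<Suc n. row_entry ?T i j \<noteq> d $ i / d $ k * row_entry ?T k j"
      by (rule rows_not_proportional[OF complementary_initial]) (use ik in auto)
    then obtain j where "j < Suc n" "row_entry ?T i j \<noteq> d $ i / d $ k * row_entry ?T k j"
      by blast
    moreover have "d $ i > 0" using ik d_pos by simp
    ultimately show ?thesis using ratio_neq[of "d $ i" "row_entry ?T i j" "d $ k" "row_entry ?T k j"] by blast
  qed
  have dn: "dim_row A = n" using A_dim by simp
  note D = arg_min_on_lexD[OF X dist r[unfolded initial_row_def dn map_divide_lex_row]]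
  show "r < n" using D(1) by simp
  show "lexpos (Suc n) (\<lambda>j. row_entry ?T i j / d $ i - row_entry ?T r j / d $ r)"
    if "i < n" "i \<noteq> r" for i
    using D(2)[of i] that by simp
qed

text \<open>The usual ratio test argument, with positivity replaced by lexicographic positivity.
  Strictness of the minimum matters for the other rows with a positive entry: they become positive
  multiples of ratio differences.\<close>

lemma lex_feasible_pivot:
  assumes T: "complementary_tableau T" "lex_feasible T" and ex: "\<exists>i<n. coef T i e > 0"
  shows "lex_feasible (pivot (leaving_row n T e) e T)"
  unfolding lex_feasible_def
proof (intro allI impI)
  define r where "r = leaving_row n T e"
  note R = leaving_rowD[OF T(1) ex r_def]
  have pos: "lexpos (Suc n) (row_entry T i)" if "i < n" for i
    using T(2) that unfolding lex_feasible_def by blast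
  have ratio: "lexpos (Suc n) (\<lambda>j. row_entry T r j / coef T r e)"
    using lexpos_scale[of "1 / coef T r e", OF _ pos[OF R(1)]] R(2) by simp
  fix i assume i: "i < n"
  consider "i = r" | "i \<noteq> r" "coef T i e > 0" | "i \<noteq> r" "coef T i e = 0" | "i \<noteq> r" "coef T i e < 0"
    by linarith
  then have "lexpos (Suc n) (row_entry (pivot r e T) i)"
  proof cases
    case 1
    then show ?thesis using ratio by (simp add: row_entry_pivot[abs_def])
  next
    case 2
    then have "lexpos (Suc n) (\<lambda>j. coef T i e * (row_entry T i j / coef T i e - row_entry T r j / coef T r e))"
      using lexpos_scale R(3) i by blast
    moreover have "coef T i e * (row_entry T i j / coef T i e - row_entry T r j / coef T r e)
        = row_entry T i j - coef T i e * (row_entry T r j / coef T r e)" for j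
      using 2 by (simp add: right_diff_distrib)
    ultimately show ?thesis using 2 by (simp add: row_entry_pivot[abs_def])
  next
    case 3
    then show ?thesis using pos[OF i] by (simp add: row_entry_pivot[abs_def])
  next
    case 4
    then have "lexpos (Suc n) (\<lambda>j. row_entry T i j + (- coef T i e) * (row_entry T r j / coef T r e))"
      using lexpos_add[OF pos[OF i] lexpos_scale[OF _ ratio, of "- coef T i e"]] by simp
    then show ?thesis using 4 by (simp add: row_entry_pivot[abs_def])
  qed
  then show "lexpos (Suc n) (row_entry (pivot (leaving_row n T e) e T) i)" by (simp add: r_def)
qed

end

section \<open>Almost complementary pivots\<close>

text \<open>Reverses the direction of travel: same basis, but the other variable of the missing pair
  enters. The value at \<open>Z0\<close> makes this a total involution.\<close>

fun flip :: "lemke_var set \<times> lemke_var \<Rightarrow> lemke_var set \<times> lemke_var" where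
  "flip (B, e) = (B, if e = Z0 then Z0 else complement e)"

lemma complement_neq_Z0: "e \<noteq> Z0 \<Longrightarrow> complement e \<noteq> Z0"
  by (cases e) auto

lemma complement_complement: "e \<noteq> Z0 \<Longrightarrow> complement (complement e) = e"
  by (cases e) auto

lemma flip_flip: "flip (flip x) = x"
  by (cases x) (auto simp: complement_neq_Z0 complement_complement)

context lemke_problem
begin

text \<open>By counting, exactly one pair is absent from the basis; the choice of \<open>e\<close>
  within it selects one of the two directions in which the path can leave this basis.\<close>

definition almost_complementary :: "tableau \<Rightarrow> lemke_var \<Rightarrow> bool" where
  "almost_complementary T e \<longleftrightarrow>
     complementary_tableau T \<and> lex_feasible T \<and> Z0 \<in> basis T \<and>
     (\<exists>p<n. (e = W p \<or> e = Z p) \<and> W p \<notin> basis T \<and> Z p \<notin> basis T)"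

text \<open>Stated on sets of basic variables, since the same basis may reappear with its rows in
  another order, and since these sets range over a finite domain.\<close>

definition move :: "lemke_var set \<times> lemke_var \<Rightarrow> lemke_var set \<times> lemke_var \<Rightarrow> bool" where
  "move x y \<longleftrightarrow> (\<exists>T e. almost_complementary T e \<and> (\<exists>i<n. coef T i e > 0) \<and>
     basic T (leaving_row n T e) \<noteq> Z0 \<and> x = (basis T, e) \<and>
     y = (basis (pivot (leaving_row n T e) e T), complement (basic T (leaving_row n T e))))"

lemma moveI:
  assumes "almost_complementary T e" "\<exists>i<n. coef T i e > 0" "r = leaving_row n T e" "basic T r \<noteq> Z0"
  shows "move (basis T, e) (basis (pivot r e T), complement (basic T r))"
  unfolding move_def using assms by blast

lemma almost_complementaryD:
  assumes "almost_complementary T e"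
  shows "complementary_tableau T" "lex_feasible T" "Z0 \<in> basis T" "e \<notin> basis T" "e \<in> vars" "e \<noteq> Z0"
    "complement e \<notin> basis T" "complement e \<noteq> e"
    "almost_complementary T (complement e)"
    "\<not> (W i \<in> insert e (basis T) \<and> Z i \<in> insert e (basis T))"
  using assms basis_complementary[of T i] unfolding almost_complementary_def vars_def by auto

text \<open>The leaving variable is not \<open>Z0\<close>, so it belongs to a pair. Its complement
  was not basic and does not enter, hence this pair is the one now missing.\<close>

lemma almost_complementary_pivot:
  assumes a: "almost_complementary T e" and ex: "\<exists>i<n. coef T i e > 0"
    and r: "r = leaving_row n T e" and l: "basic T r \<noteq> Z0"
  shows "almost_complementary (pivot r e T) (complement (basic T r))"
proof -
  note D = almost_complementaryD[OF a]
  note R = leaving_rowD[OF D(1) ex r]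
  have b: "basis (pivot r e T) = insert e (basis T - {basic T r})"
    by (rule basis_pivot[OF D(1) R(1)])
  have lb: "basic T r \<in> basis T" using R(1) by (auto simp: basis_def)
  then obtain p where p: "p < n" "basic T r = W p \<or> basic T r = Z p"
    using basis_vars[OF D(1)] l unfolding vars_def by blast
  have np: "W p \<notin> basis (pivot r e T)" "Z p \<notin> basis (pivot r e T)"
    using D(4,7) D(10)[of p] lb p(2) unfolding b by auto
  have "complementary_tableau (pivot r e T)"
    by (rule complementary_tableau_pivot[OF D(1) R(1) _ D(5)]) (use R(2) D(7) in auto)
  moreover have "lex_feasible (pivot r e T)" using lex_feasible_pivot[OF D(1,2) ex] r by simp
  moreover have "Z0 \<in> basis (pivot r e T)" using b D(3) l by auto
  moreover have "complement (basic T r) = W p \<or> complement (basic T r) = Z p" using p(2) by auto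
  ultimately show ?thesis unfolding almost_complementary_def using np p(1) by blast
qed

text \<open>After the pivot, the ratios of the rows of the new tableau exceed that of row \<open>r\<close> by
  positive multiples of lexicographically positive rows, so \<open>r\<close> is again the leaving row.\<close>

lemma leaving_row_reverse:
  assumes T: "complementary_tableau T" "lex_feasible T" and r: "r < n" and pos: "coef T r e > 0"
  shows "coef (pivot r e T) r (basic T r) > 0"
    and "leaving_row n (pivot r e T) (basic T r) = r"
proof -
  let ?T = "pivot r e T" and ?l = "basic T r"
  have c_r: "coef ?T r ?l = 1 / coef T r e"
    using coef_basic[OF T(1) r r] by (simp add: pivot_def)
  then show c_pos: "coef ?T r ?l > 0" using pos by simp
  have c_i: "coef ?T i ?l = - coef T i e / coef T r e" if "i < n" "i \<noteq> r" for i
    using coef_basic[OF T(1) _ r] coef_basic[OF T(1) r r] that by (simp add: pivot_def)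
  show "leaving_row n ?T ?l = r"
  proof (rule leaving_row_eqI[OF r c_pos])
    fix i assume i: "i < n" "coef ?T i ?l > 0" "i \<noteq> r"
    then have neg: "coef T i e < 0" using c_i[of i] pos by (simp add: divide_less_0_iff)
    have "lexpos (Suc n) (row_entry T i)" using T(2) i unfolding lex_feasible_def by blast
    then have "lexpos (Suc n) (\<lambda>j. (- coef T r e / coef T i e) * row_entry T i j)"
      using lexpos_scale[of "- coef T r e / coef T i e"] neg pos by (simp add: divide_pos_neg)
    moreover have "(- coef T r e / coef T i e) * row_entry T i j
        = row_entry ?T i j / coef ?T i ?l - row_entry ?T r j / coef ?T r ?l" for j
      using neg pos i by (simp add: c_i c_r row_entry_pivot field_simps)
    ultimately show "lexpos (Suc n) (\<lambda>j. row_entry ?T i j / coef ?T i ?l - row_entry ?T r j / coef ?T r ?l)"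
      by simp
  qed
qed

text \<open>The variable that has left re-enters in the same row and drives out \<open>e\<close>,
  which restores the old basis; the next entering variable is \<open>complement e\<close>, as in
  \<open>flip x\<close>.\<close>

lemma move_reverse:
  assumes "move x y"
  shows "move (flip y) (flip x)"
proof -
  obtain T e r where a: "almost_complementary T e" and ex: "\<exists>i<n. coef T i e > 0"
    and r: "r = leaving_row n T e" and l: "basic T r \<noteq> Z0" and x: "x = (basis T, e)"
    and y: "y = (basis (pivot r e T), complement (basic T r))"
    using assms unfolding move_def by auto
  let ?T = "pivot r e T" and ?l = "basic T r"
  note D = almost_complementaryD[OF a]
  note R = leaving_rowD[OF D(1) ex r]
  have a': "almost_complementary ?T (complement ?l)" by (rule almost_complementary_pivot[OF a ex r l])
  then have a'': "almost_complementary ?T ?l"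
    using almost_complementaryD(9)[OF a'] complement_complement[OF l] by simp
  note rev = leaving_row_reverse[OF D(1,2) R(1,2)]
  have br: "basic ?T r = e" by (simp add: pivot_def)
  have "basis (pivot r ?l ?T) = insert ?l (insert e (basis T - {?l}) - {e})"
    unfolding basis_pivot[OF almost_complementaryD(1)[OF a''] R(1)] basis_pivot[OF D(1) R(1)] br ..
  also have "\<dots> = basis T" using R(1) D(4) by (auto simp: basis_def)
  finally have bas: "basis (pivot r ?l ?T) = basis T" .
  have "move (basis ?T, ?l) (basis (pivot r ?l ?T), complement (basic ?T r))"
  proof (rule moveI[OF a''])
    show "\<exists>i<n. coef ?T i ?l > 0" using rev(1) R(1) by blast
    show "r = leaving_row n ?T ?l" using rev(2) by (rule sym)
    show "basic ?T r \<noteq> Z0" unfolding br by (rule D(6))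
  qed
  then have "move (basis ?T, ?l) (basis T, complement e)" unfolding bas br .
  then show ?thesis unfolding x y using l D(6) by (simp add: complement_neq_Z0 complement_complement)
qed

section \<open>Independence of a step from the representing tableau\<close>

lemma positive_coef_unique:
  assumes "complementary_tableau T" "complementary_tableau T'" "basis T = basis T'"
    and "\<exists>i<n. coef T i e > 0"
  shows "\<exists>i<n. coef T' i e > 0"
proof -
  obtain i where i: "i < n" "coef T i e > 0" using assms by blast
  then have "basic T i \<in> basis T'" using assms(3) by (auto simp: basis_def)
  then obtain i' where "i' < n" "basic T i = basic T' i'" by (auto simp: basis_def)
  then show ?thesis using row_unique(1)[OF assms(1-3) i(1)] i by metis
qed

text \<open>Equal bases mean that the rows of \<open>T'\<close> are those of \<open>T\<close>
  permuted. The strictly smallest ratio therefore sits in the row of the same basic variable,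
  possibly at another position.\<close>

lemma leaving_variable_unique:
  assumes T: "complementary_tableau T" and T': "complementary_tableau T'"
    and same: "basis T = basis T'" and ex: "\<exists>i<n. coef T i e > 0"
  shows "basic T' (leaving_row n T' e) = basic T (leaving_row n T e)"
proof -
  define r where "r = leaving_row n T e"
  note R = leaving_rowD[OF T ex r_def]
  have corr: "\<exists>i'<n. basic T' i = basic T i' \<and> coef T' i e = coef T i' e \<and> row_entry T' i = row_entry T i'"
    if "i < n" for i
  proof -
    have "basic T' i \<in> basis T" using same that by (auto simp: basis_def)
    then obtain i' where "i' < n" "basic T' i = basic T i'" by (auto simp: basis_def)
    then show ?thesis using row_unique(1)[OF T' T same[symmetric] that] row_entry_unique[OF T' T same[symmetric] that]
      by blast
  qed
  have "basic T r \<in> basis T'" using R(1) same by (auto simp: basis_def)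
  then obtain r' where r': "r' < n" "basic T' r' = basic T r" by (auto simp: basis_def)
  have eq: "coef T' r' e = coef T r e" "row_entry T' r' = row_entry T r"
    using row_unique(1)[OF T' T same[symmetric] r'(1) R(1) r'(2)]
      row_entry_unique[OF T' T same[symmetric] r'(1) R(1) r'(2)] by auto
  have "leaving_row n T' e = r'"
  proof (rule leaving_row_eqI[OF r'(1)])
    show "coef T' r' e > 0" using eq R by simp
    fix i assume i: "i < n" "coef T' i e > 0" "i \<noteq> r'"
    obtain i' where i': "i' < n" "basic T' i = basic T i'" "coef T' i e = coef T i' e"
      "row_entry T' i = row_entry T i'" using corr[OF i(1)] by blast
    have "i' \<noteq> r" using i i'(2) r' basic_inj[OF T'] by (metis inj_onD lessThan_iff)
    then show "lexpos (Suc n) (\<lambda>j. row_entry T' i j / coef T' i e - row_entry T' r' j / coef T' r' e)"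
      using R(3)[of i'] i i' eq by simp
  qed
  then show ?thesis using r' r_def by simp
qed

lemma move_deterministic:
  assumes "move x y" "move x y'"
  shows "y = y'"
proof -
  obtain T e where T: "almost_complementary T e" "\<exists>i<n. coef T i e > 0" "x = (basis T, e)"
    "y = (basis (pivot (leaving_row n T e) e T), complement (basic T (leaving_row n T e)))"
    using assms(1) unfolding move_def by blast
  obtain T' e' where T': "almost_complementary T' e'" "\<exists>i<n. coef T' i e' > 0" "x = (basis T', e')"
    "y' = (basis (pivot (leaving_row n T' e') e' T'), complement (basic T' (leaving_row n T' e')))"
    using assms(2) unfolding move_def by blast
  have e: "e' = e" "basis T = basis T'" using T T' by auto
  note c = almost_complementaryD(1)[OF T(1)] and c' = almost_complementaryD(1)[OF T'(1)]
  have "basic T' (leaving_row n T' e) = basic T (leaving_row n T e)"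
    using leaving_variable_unique[OF c c' e(2) T(2)] .
  then show ?thesis
    using T(4) T'(4) e basis_pivot[OF c leaving_rowD(1)[OF c T(2) refl], of e]
      basis_pivot[OF c' leaving_rowD(1)[OF c' T'(2) refl], of e] by simp
qed

text \<open>\<open>flip\<close> keeps the basis, whereas a move adds the entering variable, which
  was not basic.\<close>

lemma move_neq_flip: "move x y \<Longrightarrow> y \<noteq> flip x"
  unfolding move_def
  using almost_complementaryD(4) basis_pivot[OF almost_complementaryD(1) leaving_rowD(1)[OF almost_complementaryD(1) _ refl]]
  by fastforce

text \<open>The parameter \<open>a\<close> lets the same extension by 0 serve both the basic
  solution and the direction of a ray. For a complementary tableau the sum has at most one
  term.\<close>

definition basic_value :: "tableau \<Rightarrow> (nat \<Rightarrow> real) \<Rightarrow> lemke_var \<Rightarrow> real" where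
  "basic_value T a v = (\<Sum>r | r < n \<and> basic T r = v. a r)"

lemma basic_value_nonbasic: "v \<notin> basis T \<Longrightarrow> basic_value T a v = 0"
  unfolding basic_value_def basis_def by (intro sum.neutral) auto

lemma basic_value_nonneg: "(\<And>r. r < n \<Longrightarrow> a r \<ge> 0) \<Longrightarrow> basic_value T a v \<ge> 0"
  unfolding basic_value_def by (intro sum_nonneg) auto

lemma sum_vars:
  assumes "k < n"
  shows "(\<Sum>v\<in>vars. S k v * f v) = f (W k) - (\<Sum>i<n. A $$ (k, i) * f (Z i)) - d $ k * f Z0"
proof -
  have "(\<Sum>v\<in>vars. S k v * f v) = (\<Sum>v\<in>W ` {..<n}. S k v * f v) + (\<Sum>v\<in>Z ` {..<n}. S k v * f v) + S k Z0 * f Z0"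
    unfolding vars_def by (subst sum.union_disjoint, force, force, force)+ simp
  also have "(\<Sum>v\<in>W ` {..<n}. S k v * f v) = (\<Sum>i<n. S k (W i) * f (W i))"
    by (subst sum.reindex) (auto simp: inj_on_def simp del: system_coef.simps)
  also have "\<dots> = (\<Sum>i<n. if i = k then f (W i) else 0)"
    by (intro sum.cong) auto
  also have "(\<Sum>v\<in>Z ` {..<n}. S k v * f v) = - (\<Sum>i<n. A $$ (k, i) * f (Z i))"
    by (subst sum.reindex) (auto simp: inj_on_def sum_negf)
  finally show ?thesis using assms by simp
qed

lemma sum_vars_basic_value:
  assumes "complementary_tableau T"
  shows "(\<Sum>v\<in>vars. S k v * basic_value T a v) = (\<Sum>r<n. S k (basic T r) * a r)"
proof -
  have "(\<Sum>v\<in>vars. S k v * basic_value T a v)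
      = (\<Sum>v\<in>vars. \<Sum>r | r \<in> {..<n} \<and> basic T r = v. S k (basic T r) * a r)"
    unfolding basic_value_def by (intro sum.cong) (auto simp: sum_distrib_left)
  also have "\<dots> = (\<Sum>r<n. S k (basic T r) * a r)"
    using basis_vars[OF assms] by (intro sum.group) (auto simp: finite_vars basis_def)
  finally show ?thesis .
qed

lemma mult_A_index: "k < n \<Longrightarrow> z \<in> carrier_vec n \<Longrightarrow> (A *\<^sub>v z) $ k = (\<Sum>i<n. A $$ (k, i) * z $ i)"
  using A_dim by (auto simp: scalar_prod_def atLeast0LessThan intro!: sum.cong)

lemma dims: "dim_row A = n" "dim_col A = n" "dim_vec q = n" "dim_vec d = n"
  using A_dim q_dim d_dim by auto

text \<open>With \<open>Z0\<close> nonbasic its term drops out of the augmented system, and each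
  product of a pair vanishes because one of its members is nonbasic.\<close>

lemma complementary_solution:
  assumes T: "complementary_tableau T" and Z0: "Z0 \<notin> basis T" and pos: "\<And>r. r < n \<Longrightarrow> rhs T r \<ge> 0"
  shows "lcp_solution q A (w_part n T) (z_part n T)"
proof -
  have val: "var_value n T = basic_value T (rhs T)"
    by (simp add: fun_eq_iff var_value_def basic_value_def)
  have "w_part n T $ k - (A *\<^sub>v z_part n T) $ k = q $ k" if "k < n" for k
    using sum_vars[OF that, of "basic_value T (rhs T)"] sum_vars_basic_value[OF T, of k "rhs T"]
      system_rhs_expand[OF T that] that basic_value_nonbasic[OF Z0]
    by (simp add: mult_A_index w_part_def z_part_def val)
  then have "w_part n T - A *\<^sub>v z_part n T = q"
    by (intro eq_vecI) (auto simp: dims w_part_def)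
  moreover have "w_part n T \<bullet> z_part n T = 0"
    unfolding scalar_prod_def
  proof (intro sum.neutral ballI)
    fix i assume "i \<in> {0..<dim_vec (z_part n T)}"
    then have "i < n" by (simp add: z_part_def)
    then show "w_part n T $ i * z_part n T $ i = 0"
      using basis_complementary[OF T, of i] basic_value_nonbasic[of "W i" T] basic_value_nonbasic[of "Z i" T]
      by (auto simp: w_part_def z_part_def val)
  qed
  ultimately show ?thesis
    using basic_value_nonneg[of "rhs T", OF pos]
    unfolding lcp_solution_def by (auto simp: dims less_eq_vec_def w_part_def z_part_def val)
qed

section \<open>The first pivot\<close>

abbreviation T\<^sub>I :: tableau where "T\<^sub>I \<equiv> initial_tableau d q A"

abbreviation start_row :: nat where "start_row \<equiv> initial_row d q A"

abbreviation T\<^sub>0 :: tableau where "T\<^sub>0 \<equiv> pivot start_row Z0 T\<^sub>I"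

lemma initial_coef [simp]: "coef T\<^sub>I r v = S r v" "basic T\<^sub>I r = W r" "rhs T\<^sub>I r = q $ r"
  by (auto simp: initial_tableau_def)

lemma basis_initial: "basis T\<^sub>I = W ` {..<n}"
  by (simp add: basis_def)

lemma complementary_pivot_Z0:
  assumes "p < n"
  shows "complementary_tableau (pivot p Z0 T\<^sub>I)"
  by (rule complementary_tableau_pivot[OF complementary_initial assms])
    (use d_pos[OF assms] in \<open>auto simp: vars_def\<close>)

lemma basis_pivot_Z0:
  assumes "p < n"
  shows "basis (pivot p Z0 T\<^sub>I) = insert Z0 (W ` {..<n} - {W p})"
  using basis_pivot[OF complementary_initial assms, of Z0] by (simp add: basis_initial)

lemma row_entry_pivot_Z0:
  assumes "p < n" "i < n" "i \<noteq> p"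
  shows "row_entry (pivot p Z0 T\<^sub>I) i j = d $ i * (row_entry T\<^sub>I i j / d $ i - row_entry T\<^sub>I p j / d $ p)"
  using d_pos[OF assms(1)] d_pos[OF assms(2)] assms by (simp add: row_entry_pivot field_simps)

lemma not_nonneg_q: "\<not> 0\<^sub>v n \<le> q \<Longrightarrow> \<exists>i<n. q $ i < 0"
  using q_dim by (auto simp: less_eq_vec_def not_le)

text \<open>Some entry of \<open>q\<close> is negative, so the smallest ratio is negative and
  dividing by \<open>- d $ start_row\<close> makes the right-hand side of that row positive. Every
  other row becomes \<open>d $ i\<close> times a strict ratio difference.\<close>

lemma lex_feasible_start:
  assumes "\<not> 0\<^sub>v n \<le> q"
  shows "lex_feasible T\<^sub>0"
  unfolding lex_feasible_def
proof (intro allI impI)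
  obtain i0 where i0: "i0 < n" "q $ i0 < 0" using not_nonneg_q[OF assms] by blast
  then have "n > 0" by simp
  note R = initial_rowD[OF \<open>n > 0\<close> refl]
  have "q $ start_row / d $ start_row \<le> q $ i0 / d $ i0"
    using lexpos_nth0[OF R(2)[OF i0(1)]] by (cases "i0 = start_row") (auto simp: row_entry_def)
  also have "\<dots> < 0" using i0 d_pos by (simp add: divide_less_0_iff)
  finally have neg: "q $ start_row / d $ start_row < 0" .
  fix i assume i: "i < n"
  show "lexpos (Suc n) (row_entry T\<^sub>0 i)"
  proof (cases "i = start_row")
    case True
    have "row_entry T\<^sub>I start_row 0 = q $ start_row" by (simp add: row_entry_def)
    then have "row_entry T\<^sub>0 i 0 > 0" using neg True by (simp add: row_entry_pivot)
    then show ?thesis unfolding lexpos_def by blast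
  next
    case False
    have "row_entry T\<^sub>0 i = (\<lambda>j. d $ i * (row_entry T\<^sub>I i j / d $ i - row_entry T\<^sub>I start_row j / d $ start_row))"
      using row_entry_pivot_Z0[OF R(1) i False] by (rule ext)
    then show ?thesis using lexpos_scale[OF d_pos[OF i] R(2)[OF i False]] by simp
  qed
qed

lemma start_row_less:
  assumes "\<not> 0\<^sub>v n \<le> q"
  shows "start_row < n"
  using not_nonneg_q[OF assms] initial_rowD(1) by fastforce

lemma almost_complementary_start:
  assumes "\<not> 0\<^sub>v n \<le> q"
  shows "almost_complementary T\<^sub>0 (Z start_row)"
  unfolding almost_complementary_def
  using complementary_pivot_Z0 lex_feasible_start[OF assms] start_row_less[OF assms]
    basis_pivot_Z0[OF start_row_less[OF assms]] by auto

text \<open>Moving backwards from the start would raise the driving variable along the primary ray.\<close>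

lemma no_move_before_start:
  assumes "\<not> 0\<^sub>v n \<le> q"
  shows "\<not> move (basis T\<^sub>0, W start_row) y"
proof
  assume "move (basis T\<^sub>0, W start_row) y"
  then obtain T where T: "almost_complementary T (W start_row)" "\<exists>i<n. coef T i (W start_row) > 0"
    "basis T\<^sub>0 = basis T"
    unfolding move_def by auto
  note r = start_row_less[OF assms]
  obtain i where i: "i < n" "coef T\<^sub>0 i (W start_row) > 0"
    using positive_coef_unique[OF almost_complementaryD(1)[OF T(1)] complementary_pivot_Z0[OF r] T(3)[symmetric] T(2)]
    by blast
  \<comment> \<open>The entry is \<open>- 1 / d $ start_row\<close> in the pivot row and
    \<open>- d $ i / d $ start_row\<close> in every other row.\<close>
  moreover have "coef T\<^sub>0 i (W start_row) \<le> 0"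
    using i(1) d_pos[OF r] d_pos[OF i(1)] by (auto simp: pivot_def divide_simps)
  ultimately show False by simp
qed

text \<open>The basis is the one reached by bringing in \<open>Z0\<close> at row \<open>p\<close>.
  If \<open>p\<close> differs from \<open>start_row\<close>, the row of \<open>W start_row\<close>
  is a positive multiple of its initial ratio minus that of row \<open>p\<close>, which is
  lexicographically negative by the choice of \<open>start_row\<close>.\<close>

lemma start_row_unique:
  assumes T: "complementary_tableau T" "lex_feasible T" and p: "p < n"
    and b: "basis T = insert Z0 (W ` {..<n} - {W p})"
  shows "p = start_row"
proof (rule ccontr)
  assume "p \<noteq> start_row"
  have "n > 0" using p by simp
  note R = initial_rowD[OF \<open>n > 0\<close> refl]
  let ?P = "pivot p Z0 T\<^sub>I" and ?r = start_row
  have "W ?r \<in> basis T" using b R(1) \<open>p \<noteq> ?r\<close> by auto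
  then obtain i where i: "i < n" "basic T i = W ?r" by (auto simp: basis_def)
  have "row_entry T i = row_entry ?P ?r"
    using row_entry_unique[OF T(1) complementary_pivot_Z0[OF p] _ i(1) R(1)] b basis_pivot_Z0[OF p] i(2)
      \<open>p \<noteq> ?r\<close> by (simp add: pivot_def)
  also have "\<dots> = (\<lambda>j. d $ ?r * (row_entry T\<^sub>I ?r j / d $ ?r - row_entry T\<^sub>I p j / d $ p))"
    using row_entry_pivot_Z0[OF p R(1)] \<open>p \<noteq> ?r\<close> by auto
  finally have "lexpos (Suc n) (\<lambda>j. d $ ?r * (row_entry T\<^sub>I ?r j / d $ ?r - row_entry T\<^sub>I p j / d $ p))"
    using T(2) i(1) unfolding lex_feasible_def by metis
  moreover have "d $ ?r * (row_entry T\<^sub>I ?r j / d $ ?r - row_entry T\<^sub>I p j / d $ p)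
      = - (d $ ?r * (row_entry T\<^sub>I p j / d $ p - row_entry T\<^sub>I ?r j / d $ ?r))" for j
    by (simp add: right_diff_distrib)
  ultimately have "lexpos (Suc n) (\<lambda>j. - (d $ ?r * (row_entry T\<^sub>I p j / d $ p - row_entry T\<^sub>I ?r j / d $ ?r)))"
    by (simp only:)
  then show False
    using lexpos_not_uminus[OF lexpos_scale[OF d_pos[OF R(1)] R(2)[OF p \<open>p \<noteq> ?r\<close>]]] by contradiction
qed

section \<open>Secondary rays\<close>

text \<open>The direction of the edge: the entering variable grows at rate 1, and the basic variable
  of row \<open>r\<close> responds at rate \<open>- coef T r e\<close>.\<close>

definition ray :: "tableau \<Rightarrow> lemke_var \<Rightarrow> lemke_var \<Rightarrow> real" where
  "ray T e v = of_bool (v = e) + basic_value T (\<lambda>r. - coef T r e) v"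

context
  fixes T :: tableau and e :: lemke_var
  assumes ac: "almost_complementary T e" and unblocked: "\<forall>r<n. coef T r e \<le> 0"
begin

lemma ray_nonneg: "ray T e v \<ge> 0"
  unfolding ray_def using unblocked by (intro add_nonneg_nonneg basic_value_nonneg) auto

lemma ray_support: "ray T e v \<noteq> 0 \<Longrightarrow> v \<in> insert e (basis T)"
  unfolding ray_def using basic_value_nonbasic by fastforce

lemma ray_complementary:
  "ray T e (W i) \<noteq> 0 \<Longrightarrow> Z i \<notin> insert e (basis T)"
  "ray T e (Z i) \<noteq> 0 \<Longrightarrow> W i \<notin> insert e (basis T)"
  using ray_support almost_complementaryD(10)[OF ac] by blast+

lemma ray_entering: "ray T e e = 1"
  unfolding ray_def using basic_value_nonbasic[OF almost_complementaryD(4)[OF ac]] by simp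

text \<open>The ray solves the homogeneous augmented system, because the entering column cancels
  against its expansion in the basic columns.\<close>

lemma ray_system:
  assumes k: "k < n"
  shows "ray T e (W k) = (\<Sum>i<n. A $$ (k, i) * ray T e (Z i)) + d $ k * ray T e Z0"
proof -
  note D = almost_complementaryD[OF ac]
  have "(\<Sum>v\<in>vars. S k v * ray T e v)
      = (\<Sum>v\<in>vars. if v = e then S k v else 0) + (\<Sum>v\<in>vars. S k v * basic_value T (\<lambda>r. - coef T r e) v)"
    unfolding ray_def by (simp add: sum.distrib[symmetric] distrib_left) (intro sum.cong, auto)
  also have "\<dots> = S k e - (\<Sum>r<n. S k (basic T r) * coef T r e)"
    using D(5) by (simp add: sum_vars_basic_value[OF D(1)] finite_vars sum_negf)
  also have "\<dots> = 0" using system_expand[OF D(1) k, of e] by simp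
  finally show ?thesis using sum_vars[OF k, of "ray T e"] by simp
qed

text \<open>Without a \<open>Z\<close> part the ray satisfies \<open>w = d z0\<close>, and
  \<open>z0\<close> is nonzero because the ray is. So every \<open>W k\<close> is basic or entering;
  counting leaves only a basis reached by a first pivot in some row, and lexicographic feasibility
  fixes that row.\<close>

lemma ray_primary:
  assumes "\<forall>i<n. ray T e (Z i) = 0"
  shows "(basis T, e) = (basis T\<^sub>0, W start_row)"
proof -
  note D = almost_complementaryD[OF ac]
  have w: "ray T e (W k) = d $ k * ray T e Z0" if "k < n" for k
    using ray_system[OF that] assms by simp
  have "ray T e Z0 \<noteq> 0"
  proof
    assume "ray T e Z0 = 0"
    then have "ray T e v = 0" if "v \<in> vars" for v using that w assms unfolding vars_def by auto
    then show False using D(5) ray_entering by fastforce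
  qed
  then have W: "W k \<in> insert e (basis T)" if "k < n" for k
    using ray_support[of "W k"] w[OF that] d_pos[OF that] by simp
  obtain p where p: "p < n" "e = W p \<or> e = Z p" "W p \<notin> basis T"
    using ac unfolding almost_complementary_def by blast
  \<comment> \<open>The alternative \<open>e = Z p\<close> fails since the ray is 1 at
    \<open>e\<close> but 0 at every \<open>Z i\<close>.\<close>
  have e: "e = W p" using p assms ray_entering by auto
  have "insert Z0 (W ` {..<n} - {W p}) \<subseteq> basis T" using W D(3) e by auto
  moreover have "card (insert Z0 (W ` {..<n} - {W p})) = n"
    using p(1) by (simp add: card_insert_if card_Diff_singleton_if card_image inj_on_def image_iff)
  ultimately have b: "insert Z0 (W ` {..<n} - {W p}) = basis T"
    using card_subset_eq[of "basis T"] basis_card[OF D(1)] by (simp add: basis_def)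
  then have "p = start_row" using start_row_unique[OF D(1,2) p(1)] by simp
  then show ?thesis using b basis_pivot_Z0 p(1) e by simp
qed

end

text \<open>If \<open>z0\<close> grew along the ray, semimonotonicity would give an \<open>i\<close>
  with \<open>x_i > 0\<close> and \<open>w_i = (A x)_i + d_i z0 > 0\<close>, against
  complementarity. With \<open>z0 = 0\<close> the ray solves the homogeneous problem.\<close>

lemma SOL0_ray:
  assumes ac: "almost_complementary T e" and unblocked: "\<forall>r<n. coef T r e \<le> 0"
    and semi: "semimonotone A" and nz: "\<exists>i<n. ray T e (Z i) \<noteq> 0"
  shows "ray T e Z0 = 0" and "vec n (\<lambda>i. ray T e (Z i)) \<in> SOL0 A"
    and "\<And>k. k < n \<Longrightarrow> (A *\<^sub>v vec n (\<lambda>i. ray T e (Z i))) $ k = ray T e (W k)"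
proof -
  define x where "x = vec n (\<lambda>i. ray T e (Z i))"
  have x: "x \<in> carrier_vec n" "0\<^sub>v n \<le> x" "x \<noteq> 0\<^sub>v n"
    using nz ray_nonneg[OF ac unblocked] by (auto simp: x_def less_eq_vec_def vec_eq_iff)
  have Ax: "ray T e (W k) = (A *\<^sub>v x) $ k + d $ k * ray T e Z0" if "k < n" for k
    using ray_system[OF ac unblocked that] mult_A_index[OF that x(1)] by (simp add: x_def)
  show z0: "ray T e Z0 = 0"
  proof (rule ccontr)
    assume "ray T e Z0 \<noteq> 0"
    then have pos: "ray T e Z0 > 0" using ray_nonneg[OF ac unblocked, of Z0] by simp
    obtain i where i: "i < n" "x $ i > 0" "(A *\<^sub>v x) $ i \<ge> 0"
      using semi x unfolding semimonotone_def by (auto simp: dims)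
    have "ray T e (W i) > 0" using Ax[OF i(1)] i(3) mult_pos_pos[OF d_pos[OF i(1)] pos] by simp
    then have "Z i \<notin> insert e (basis T)" using ray_complementary(1)[OF ac unblocked, of i] by simp
    moreover have "Z i \<in> insert e (basis T)"
      using ray_support[OF ac unblocked, of "Z i"] i by (simp add: x_def)
    ultimately show False by blast
  qed
  show Axk: "(A *\<^sub>v vec n (\<lambda>i. ray T e (Z i))) $ k = ray T e (W k)" if "k < n" for k
    using Ax[OF that] z0 by (simp add: x_def)
  have "x \<bullet> (A *\<^sub>v x) = 0"
    unfolding scalar_prod_def
  proof (intro sum.neutral ballI)
    fix i assume "i \<in> {0..<dim_vec (A *\<^sub>v x)}"
    then have "i < n" by (simp add: dims)
    then show "x $ i * (A *\<^sub>v x) $ i = 0"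
      using Axk ray_complementary(2)[OF ac unblocked, of i] ray_support[OF ac unblocked, of "W i"]
      by (auto simp: x_def)
  qed
  then show "vec n (\<lambda>i. ray T e (Z i)) \<in> SOL0 A"
    using x Axk ray_nonneg[OF ac unblocked]
    unfolding SOL0_def x_def by (auto simp: dims less_eq_vec_def)
qed

section \<open>The certificate of infeasibility\<close>

text \<open>The vector \<open>x\<close> is a Farkas certificate: \<open>x >= 0\<close>,
  \<open>A^T x <= 0\<close> and \<open>x^T q < 0\<close>. The last property holds because
  \<open>x\<close> is \<open>- dx\<close> times the multiplier row that produces the tableau row of
  \<open>Z0\<close>.\<close>

lemma secondary_ray_infeasible:
  assumes ac: "almost_complementary T e" and unblocked: "\<forall>r<n. coef T r e \<le> 0"
    and E: "E0s_tilde A" and nz: "\<exists>i<n. ray T e (Z i) \<noteq> 0"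
  shows "\<not> lcp_feasible q A"
proof
  define x where "x = vec n (\<lambda>i. ray T e (Z i))"
  note D = almost_complementaryD[OF ac]
  have semi: "semimonotone A" using E unfolding E0s_tilde_def E0s_def by blast
  note X = SOL0_ray[OF ac unblocked semi nz, folded x_def]
  have xi: "x $ i = ray T e (Z i)" "x $ i \<ge> 0" if "i < n" for i
    using that ray_nonneg[OF ac unblocked] by (auto simp: x_def)
  define y where "y i = (\<Sum>k<n. x $ k * A $$ (k, i))" for i
  have At: "(transpose_mat A *\<^sub>v x) $ i = y i" if "i < n" for i
    using that A_dim by (auto simp: y_def x_def scalar_prod_def atLeast0LessThan mult.commute intro!: sum.cong)
  have "transpose_mat A *\<^sub>v x \<le> 0\<^sub>v n"
    using E X(2) unfolding E0s_tilde_def E0s_def dims by blast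
  then have y_le: "y i \<le> 0" if "i < n" for i
    using that At[OF that] unfolding less_eq_vec_def by (metis index_zero_vec)
  \<comment> \<open>Here the extra condition of the tilde class enters: \<open>y i\<close> is
    nonzero only where \<open>A x\<close>, the \<open>W\<close> part of the ray, is nonzero, and
    there \<open>Z i\<close> is not basic.\<close>
  have y_supp: "Z i \<notin> basis T" if "i < n" "y i \<noteq> 0" for i
  proof -
    have "(transpose_mat A *\<^sub>v x) $ i \<noteq> 0 \<longrightarrow> (A *\<^sub>v x) $ i \<noteq> 0"
      using E X(2) that(1) unfolding E0s_tilde_def dims by blast
    then have "(A *\<^sub>v x) $ i \<noteq> 0" using At[OF that(1)] that(2) by argo
    then show ?thesis using X(3)[OF that(1)] ray_complementary(1)[OF ac unblocked, of i] by auto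
  qed
  define dx where "dx = (\<Sum>k<n. x $ k * d $ k)"
  obtain i1 where i1: "i1 < n" "x $ i1 > 0" using nz xi by (metis less_eq_real_def)
  have dx: "dx > 0"
    unfolding dx_def using i1 d_pos xi(2)
    by (intro sum_pos2[of _ i1]) (auto intro: mult_nonneg_nonneg less_imp_le)
  obtain r where r: "r < n" "basic T r = Z0" using D(3) by (auto simp: basis_def)
  \<comment> \<open>Basic \<open>W\<close> columns give 0 by complementarity with the support of
    \<open>x\<close>, basic \<open>Z\<close> columns by \<open>y_supp\<close>; only the column
    \<open>- d\<close> of \<open>Z0\<close> remains.\<close>
  have cols: "(\<Sum>k<n. x $ k * S k (basic T s)) = (if s = r then - dx else 0)" if s: "s < n" for s
  proof -
    have bs: "basic T s \<in> basis T" using s by (auto simp: basis_def)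
    then consider i where "i < n" "basic T s = W i" | i where "i < n" "basic T s = Z i" | "basic T s = Z0"
      using basis_vars[OF D(1)] unfolding vars_def by blast
    then show ?thesis
    proof cases
      case 1
      then have "x $ i = 0" using xi(1) ray_complementary(2)[OF ac unblocked, of i] bs by auto
      moreover have "(\<Sum>k<n. x $ k * S k (basic T s)) = (\<Sum>k<n. if k = i then x $ k else 0)"
        unfolding 1 by (intro sum.cong) auto
      ultimately show ?thesis using 1 r by auto
    next
      case 2
      then have "y i = 0" using y_supp bs by auto
      then show ?thesis using 2 r by (auto simp: y_def sum_negf)
    next
      case 3
      then have "s = r" using basic_inj[OF D(1)] s r by (metis inj_onD lessThan_iff)
      then show ?thesis using 3 by (simp add: dx_def sum_negf)
    qed
  qed
  have swap: "(\<Sum>k<n. x $ k * (\<Sum>s<n. S k (basic T s) * g s)) = - dx * g r" for g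
  proof -
    have "(\<Sum>k<n. x $ k * (\<Sum>s<n. S k (basic T s) * g s))
        = (\<Sum>s<n. (\<Sum>k<n. x $ k * S k (basic T s)) * g s)"
      by (simp add: sum_distrib_left sum_distrib_right mult.assoc) (rule sum.swap)
    also have "\<dots> = (\<Sum>s<n. if s = r then - dx * g s else 0)" by (intro sum.cong) (auto simp: cols)
    finally show ?thesis using r(1) by simp
  qed
  have xj: "x $ j = - dx * coef T r (W j)" if "j < n" for j
  proof -
    have "x $ j = (\<Sum>k<n. if k = j then x $ k else 0)" using that by simp
    also have "\<dots> = (\<Sum>k<n. x $ k * S k (W j))" by (intro sum.cong) auto
    also have "\<dots> = (\<Sum>k<n. x $ k * (\<Sum>s<n. S k (basic T s) * coef T s (W j)))"
      using system_expand[OF D(1), of _ "W j"] by (intro sum.cong) auto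
    finally show ?thesis using swap by simp
  qed
  have xq: "(\<Sum>k<n. x $ k * q $ k) = - dx * rhs T r"
  proof -
    have "(\<Sum>k<n. x $ k * q $ k) = (\<Sum>k<n. x $ k * (\<Sum>s<n. S k (basic T s) * rhs T s))"
      using system_rhs_expand[OF D(1)] by (intro sum.cong) auto
    then show ?thesis using swap by simp
  qed
  have lp: "lexpos (Suc n) (row_entry T r)" using D(2) r(1) unfolding lex_feasible_def by blast
  \<comment> \<open>A lexicographically positive row with \<open>rhs\<close> 0 has a positive entry
    in some column \<open>W k\<close>, and \<open>xj\<close> would then make \<open>x $ k\<close>
    negative.\<close>
  have "rhs T r \<noteq> 0"
  proof
    assume 0: "rhs T r = 0"
    obtain j where j: "j < Suc n" "row_entry T r j > 0" using lp unfolding lexpos_def by blast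
    then obtain k where k: "k < n" "coef T r (W k) > 0"
      using 0 by (cases j) (auto simp: row_entry_def)
    then show False using xj[OF k(1)] xi(2)[OF k(1)] mult_pos_pos[OF dx k(2)] by simp
  qed
  then have "rhs T r > 0" using lexpos_nth0[OF lp] by (simp add: row_entry_def)
  then have xq_neg: "(\<Sum>k<n. x $ k * q $ k) < 0" using xq dx by simp
  assume "lcp_feasible q A"
  then obtain z where z: "z \<in> carrier_vec n" "0\<^sub>v n \<le> z" "0\<^sub>v n \<le> q + A *\<^sub>v z"
    unfolding lcp_feasible_def by (auto simp: dims)
  have zi: "z $ i \<ge> 0" if "i < n" for i using z that by (auto simp: less_eq_vec_def)
  have "q $ k + (\<Sum>i<n. A $$ (k, i) * z $ i) \<ge> 0" if "k < n" for k
    using z(3) that mult_A_index[OF that z(1)] by (auto simp: less_eq_vec_def dims)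
  then have "0 \<le> (\<Sum>k<n. x $ k * (q $ k + (\<Sum>i<n. A $$ (k, i) * z $ i)))"
    using xi(2) by (intro sum_nonneg) auto
  also have "\<dots> = (\<Sum>k<n. x $ k * q $ k) + (\<Sum>k<n. \<Sum>i<n. x $ k * A $$ (k, i) * z $ i)"
    by (simp add: distrib_left sum.distrib sum_distrib_left mult.assoc)
  also have "(\<Sum>k<n. \<Sum>i<n. x $ k * A $$ (k, i) * z $ i) = (\<Sum>i<n. y i * z $ i)"
    unfolding y_def sum_distrib_right by (rule sum.swap)
  also have "\<dots> \<le> 0" using y_le zi by (intro sum_nonpos) (auto intro: mult_nonpos_nonneg)
  finally show False using xq_neg by simp
qed

section \<open>Runs of the algorithm\<close>

text \<open>Final states are fixed by \<open>lemke_step\<close>, so a run can be indexed by all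
  natural numbers.\<close>

definition state :: "nat \<Rightarrow> lemke_state" where
  "state k = (lemke_step n ^^ k) (lemke_init d q A)"

lemma state_Suc: "state (Suc k) = lemke_step n (state k)"
  by (simp add: state_def)

lemma lemke_step_cases:
  assumes "r = leaving_row n T e"
  shows "lemke_step n (Active T e) =
    (if \<exists>i<n. coef T i e > 0
     then if basic T r = Z0 then Solved (pivot r e T) else Active (pivot r e T) (complement (basic T r))
     else Secondary_Ray T e)"
  using assms by (auto simp: Let_def not_le)

context
  assumes q_neg: "\<not> 0\<^sub>v n \<le> q"
begin

lemma state_0: "state 0 = Active T\<^sub>0 (Z start_row)"
  using q_neg by (simp add: state_def lemke_init_def dims Let_def)

lemma active_state: "state k = Active T e \<Longrightarrow> almost_complementary T e"
proof (induction k arbitrary: T e)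
  case 0
  then show ?case using state_0 almost_complementary_start[OF q_neg] by simp
next
  case (Suc k)
  show ?case
  proof (cases "state k")
    case (Active T' e')
    then have a: "almost_complementary T' e'" by (rule Suc.IH)
    show ?thesis
      using Suc.prems almost_complementary_pivot[OF a _ refl]
      unfolding state_Suc Active lemke_step_cases[OF refl] by (auto split: if_splits)
  qed (use Suc.prems in \<open>auto simp: state_Suc\<close>)
qed

text \<open>Keeping only the basic variables and the entering one leaves finitely many values along
  a run.\<close>

fun key :: "lemke_state \<Rightarrow> lemke_var set \<times> lemke_var" where
  "key (Active T e) = (basis T, e)"
| "key (Solved T) = (basis T, Z0)"
| "key (Secondary_Ray T e) = (basis T, e)"

lemma active_move:
  assumes "is_active (state k)" "is_active (state (Suc k))"
  shows "move (key (state k)) (key (state (Suc k)))"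
proof -
  obtain T e where s: "state k = Active T e" using assms(1) by (cases "state k") auto
  note a = active_state[OF s]
  have "(\<exists>i<n. coef T i e > 0) \<and> basic T (leaving_row n T e) \<noteq> Z0"
    using assms(2) unfolding state_Suc s lemke_step_cases[OF refl] by (auto split: if_splits)
  then show ?thesis
    using moveI[OF a _ refl] unfolding state_Suc s lemke_step_cases[OF refl] by simp
qed

lemma flip_key_0: "flip (key (state 0)) = (basis T\<^sub>0, W start_row)"
  by (simp add: state_0)

text \<open>An endless run would be an infinite path of moves in the finite set
  \<open>Pow vars \<times> vars\<close>, while no move leads out of its flipped start.\<close>

lemma lemke_terminates: "\<exists>k. \<not> is_active (state k)"
proof (rule ccontr)
  assume "\<not> ?thesis"
  then have act: "is_active (state k)" for k by blast
  have "key (state k) \<in> Pow vars \<times> vars" for k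
  proof -
    obtain T e where s: "state k = Active T e" using act by (metis is_active.elims(2))
    show ?thesis
      using almost_complementaryD(5)[OF active_state[OF s]]
        basis_vars[OF almost_complementaryD(1)[OF active_state[OF s]]] unfolding s by simp
  qed
  then have "range (\<lambda>k. key (state k)) \<subseteq> Pow vars \<times> vars" by (rule image_subsetI)
  then have fin: "finite (range (\<lambda>k. key (state k)))"
    by (rule finite_subset) (simp add: finite_vars)
  show False
  proof (rule reversible_no_infinite_path[where R = move and f = flip and s = "\<lambda>k. key (state k)",
        OF move_deterministic move_reverse flip_flip active_move[OF act act] fin])
    show "\<not> move (flip (key (state 0))) y" for y
      unfolding flip_key_0 by (rule no_move_before_start[OF q_neg])
  qed
qed

text \<open>A ray without \<open>Z\<close> part would place the run at its flipped start. Entering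
  variables of active states differ from \<open>Z0\<close>, so \<open>flip\<close> has no fixed
  point on the way and the palindrome argument applies.\<close>

lemma ray_not_primary:
  assumes act: "\<And>j. j \<le> k \<Longrightarrow> is_active (state j)"
    and s: "state k = Active T e" and ub: "\<forall>r<n. coef T r e \<le> 0"
  shows "\<exists>i<n. ray T e (Z i) \<noteq> 0"
proof (rule ccontr)
  assume "\<not> ?thesis"
  then have "key (state k) = flip (key (state 0))"
    using ray_primary[OF active_state[OF s] ub] s flip_key_0 by simp
  moreover have "key (state k) \<noteq> flip (key (state 0))"
  proof (rule reversible_path_no_return[where R = move and f = flip and s = "\<lambda>k. key (state k)" and m = k,
        OF move_deterministic move_reverse flip_flip _ _ move_neq_flip])
    show "move (key (state i)) (key (state (Suc i)))" if "i < k" for i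
      using active_move act that by simp
    show "flip (key (state i)) \<noteq> key (state i)" if ik: "i \<le> k" for i
    proof -
      obtain T' e' where s': "state i = Active T' e'" using act[OF ik] by (metis is_active.elims(2))
      show ?thesis using almost_complementaryD(6,8)[OF active_state[OF s']] s' by simp
    qed
  qed
  ultimately show False by contradiction
qed

lemma processable_negative:
  assumes E: "E0s_tilde A"
  shows "processable_by_lemke d q A"
proof -
  \<comment> \<open>The least stopping index is the one that defines the result of
    \<open>while_option\<close>; its predecessor is active, so the last step can be
    analysed.\<close>
  define K where "K = (LEAST k. \<not> is_active (state k))"
  have run: "lemke d q A = Some (state K)"
    using lemke_terminates unfolding lemke_def while_option_def K_def state_def by (simp add: dims)
  have K: "\<not> is_active (state K)" unfolding K_def using lemke_terminates by (rule LeastI_ex)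
  have below: "is_active (state j)" if "j < K" for j
    using not_less_Least[of j "\<lambda>k. \<not> is_active (state k)"] that unfolding K_def by blast
  have "K \<noteq> 0" using K state_0 by (metis is_active.simps(1))
  then obtain k where k: "K = Suc k" using not0_implies_Suc by blast
  obtain T e where s: "state k = Active T e" using below[of k] k by (metis is_active.elims(2) lessI)
  note a = active_state[OF s] and D = almost_complementaryD[OF active_state[OF s]]
  define r where "r = leaving_row n T e"
  note step = lemke_step_cases[OF r_def]
  show ?thesis
  proof (cases "\<exists>i<n. coef T i e > 0")
    case True
    note R = leaving_rowD[OF D(1) True r_def]
    \<comment> \<open>With a blocking row present, the run can only have stopped because
      \<open>Z0\<close> left the basis.\<close>
    have l: "basic T r = Z0" and t: "state K = Solved (pivot r e T)"
      using K True unfolding k state_Suc s step by (auto split: if_splits)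
    have "complementary_tableau (pivot r e T)"
      by (rule complementary_tableau_pivot[OF D(1) R(1) _ D(5)]) (use R(2) D(7) in auto)
    moreover have "Z0 \<notin> basis (pivot r e T)"
      unfolding basis_pivot[OF D(1) R(1)] using l D(6) by auto
    moreover have "rhs (pivot r e T) i \<ge> 0" if "i < n" for i
      using lex_feasible_pivot[OF D(1,2) True] lexpos_nth0[of n "row_entry (pivot r e T) i"] that
      unfolding lex_feasible_def r_def[symmetric] by (simp add: row_entry_def)
    ultimately show ?thesis
      unfolding processable_by_lemke_def run t using complementary_solution by (simp add: dims)
  next
    case False
    then have ub: "\<forall>r<n. coef T r e \<le> 0" by (meson not_le)
    have t: "state K = Secondary_Ray T e" using False unfolding k state_Suc s step by simp
    have "\<exists>i<n. ray T e (Z i) \<noteq> 0" using ray_not_primary[OF _ s ub] below k by simp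
    then show ?thesis
      unfolding processable_by_lemke_def run t using secondary_ray_infeasible[OF a ub E] by simp
  qed
qed

end

text \<open>The initial basis does not contain \<open>Z0\<close>, so its basic solution
  \<open>w = q\<close>, \<open>z = 0\<close> falls under
  \<open>complementary_solution\<close>.\<close>

lemma processable_nonneg:
  assumes "0\<^sub>v n \<le> q"
  shows "processable_by_lemke d q A"
proof -
  have "lemke d q A = Some (Solved T\<^sub>I)"
    using assms unfolding lemke_def lemke_init_def dims by (simp add: while_option_unfold)
  moreover have "lcp_solution q A (w_part n T\<^sub>I) (z_part n T\<^sub>I)"
    using assms complementary_initial
    by (intro complementary_solution) (auto simp: basis_initial less_eq_vec_def dims)
  ultimately show ?thesis unfolding processable_by_lemke_def by (simp add: dims)
qed

end

theorem corollary2: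
  fixes n :: nat and A :: "real mat" and d :: "real vec"
  assumes "A \<in> carrier_mat n n"
    and "E0s_tilde A"
    and "\<forall>M \<in> legitimate_ppts A. almost_E M \<or> completely_E0s_tilde M"
    and "d \<in> carrier_vec n" and "\<forall>i<n. d $ i > 0"
  shows "\<forall>q \<in> carrier_vec n. processable_by_lemke d q A"
proof
  fix q :: "real vec" assume "q \<in> carrier_vec n"
  then interpret lemke_problem n A d q
    using assms by unfold_locales auto
  show "processable_by_lemke d q A"
    using processable_nonneg processable_negative[OF _ assms(2)] by blast
qed

end
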